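(* Let $T\ge 2$ be an integer and $p\in(0,1)$. Let $\{U_n\}_{n\ge 0}$ be a sequence of independent random variables with $U_{kT}=1$ almost surely for all $k\ge 0$ and $U_n$ Bernoulli with parameter $p$ for every $n\ge 0$ that is not a multiple of $T$. Let $\{X_n\}_{n\ge 0}$ be a strictly stationary sequence of positive random variables with continuous marginal distribution function $F$, independent of $\{U_n\}_{n\ge 0}$. Define $$Y_n=U_nX_n+(1-U_n)\max_{[(n-1)/T]\,T\le i\le n-1}U_iX_i,\qquad n\ge 1 .$$ Let $\{u_n\}_{n\ge1}$ be a sequence of positive real numbers with $$n(1-F(u_n))\to\tau_{\mathbf X}\in(0,\infty),\qquad n(1-G_j(u_n))\to\tau_j\quad (2\le j\le T-1),$$ where $G_j$ is the distribution function of $\max_{0\le i\le j-1}U_iX_i$ (the second requirement being void for $T=2$), and set $$\tau=\frac1T\Big\{((T-2)p+2)\tau_{\mathbf X}+(1-p)\sum_{j=2}^{T-1}\tau_j\Big\}.$$ Assume that $\{X_n\}$ and $\{Y_n\}$ satisfy condition $D(u_n)$ with a sequence $\ell_n=o(n)$, that $\{k_n\}$ is a sequence of positive integers with $k_n\to+\infty$, $k_n\ell_n/n\to0$, $k_n\alpha_{n,\ell_n}\to0$ (for the mixing coefficients $\alpha_{n,\ell_n}$ of both sequences), that $\{X_n\}$ has extremal index $\theta_{\mathbf X}$, and that $$nP\Big(\max_{0\le j\le T}X_j>u_n,\ M^{(\mathbf X)}_{T+1,\,[\frac{n}{k_nT}]T+T}>u_n\Big)\longrightarrow0 .$$ Then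 $\{Y_n\}_{n\ge1}$ satisfies condition $D_T^{(T)}(u_n)$ and, whenever the limits defining the $P^*_{i,T}$ below exist, the extremal index of $\{Y_n\}$ is $$\theta_{\mathbf Y}=\frac{\tau_{\mathbf X}}{\tau}\,\theta_{\mathbf X}\,p^{T-1}+\frac1{\tau T}\sum_{i=1}^{T-1}P^*_{i,T},$$ where $$\begin{aligned}P^*_{i,T}=\lim_{n\to+\infty}n\Big(&\sum_{I\subsetneq\overline S_i}P\big(X_i>u_n,\ M^{(\mathbf X)}(S_i\cup I)\le u_n\big)\,p^{|I|+T-i}(1-p)^{i-1-|I|}\\&+\sum_{J\subseteq\underline S_i}\ \sum_{I\subseteq\overline S_i}P\big(M^{(\mathbf X)}(J\cup\{0\})>u_n,\ M^{(\mathbf X)}(S_i\cup I)\le u_n\big)\,p^{|I|+|J|+T-i-1}(1-p)^{2i-1-|I|-|J|}\Big),\end{aligned}$$ with $S_i=\{i+1,\dots,T\}$ for $1\le i\le T-1$, $\overline S_1=\underline S_1=\emptyset$, and $\overline S_i=\{T+1,\dots,T+i-1\}$, $\underline S_i=\{1,\dots,i-1\}$ for $2\le i\le T-1$.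
   Context: $[a]$ denotes the integer part of $a$. For a sequence $\mathbf W=\{W_n\}$ of random variables, $M^{(\mathbf W)}_{i,j}=\max_{i\le m\le j}W_m$ for $i\le j$, $M^{(\mathbf W)}_{i,j}=-\infty$ for $i>j$, and $M^{(\mathbf W)}(B)=\max_{m\in B}W_m$ for a finite set $B$ of indices. Sums over $I\subsetneq\overline S_i$ run over all proper subsets (so for $i=1$ this sum is empty and equals $0$); sums over $I\subseteq\overline S_i$, $J\subseteq\underline S_i$ run over all subsets (including $\emptyset$). Condition $D(u_n)$ for $\mathbf W$: there is a sequence $\ell_n=o(n)$ such that $\alpha_{n,\ell_n}\to0$, where $\alpha_{n,\ell_n}$ is the supremum of $|P(M^{(\mathbf W)}_{i_1,i_1+a}\le u_n, M^{(\mathbf W)}_{j_1,j_1+b}\le u_n)-P(M^{(\mathbf W)}_{i_1,i_1+a}\le u_n)P(M^{(\mathbf W)}_{j_1,j_1+b}\le u_n)|$ over all integers with $1\le i_1<i_1+a+\ell_n\le j_1<j_1+b\le n$. Condition $D_T^{(s)}(u_n)$ ($s\ge1$) for $\{Y_n\}$ (which is a $T$-periodic sequence): $\{Y_n\}$ satisfies $D(u_n)$ and there is a sequence of integers $k_n\to+\infty$ with $k_n\ell_n/n\to0$, $k_n\alpha_{n,\ell_n}\to0$ and $$\lim_{n\to+\infty}\frac nT\sum_{i=1}^{T}P\Big(Y_i>u_n\ge M^{(\mathbf Y)}_{i+1,i+s-1},\ M^{(\mathbf Y)}_{i+s,[\frac{n}{k_nT}]T}>u_n\Big)=0.$$ Extremal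 indices: $\theta_{\mathbf X}=-\frac1{\tau_{\mathbf X}}\log\lim_{n}P(M^{(\mathbf X)}_{1,n}\le u_n)$; and $\theta_{\mathbf Y}=-\frac1\tau\log\lim_{n}P(M^{(\mathbf Y)}_{1,n}\le u_n)$, where $\tau=\lim_n \frac nT\sum_{j=1}^T P(Y_j>u_n)$, which equals the $\tau$ given in the claim. *)

theory Defs
  imports "HOL-Probability.Probability" "HOL-Library.Landau_Symbols"
begin

text \<open>
  A sequence of random variables is a function \<open>W\<close> with \<open>W n \<omega>\<close> the value of the \<open>n\<close>-th variable
  at \<open>\<omega>\<close>. The maximum over a finite index set takes values in the extended reals, since the
  maximum over the empty set is \<open>-\<infinity>\<close> (which is the supremum of the empty set there).
  The quantity $M^{(W)}_{i,j}$ is \<open>max_over W {i..j}\<close>, as \<open>{i..j}\<close> is empty for \<open>i > j\<close>.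
\<close>

definition max_over :: "(nat \<Rightarrow> 'a \<Rightarrow> real) \<Rightarrow> nat set \<Rightarrow> 'a \<Rightarrow> ereal" where
  "max_over W B \<omega> = (SUP m\<in>B. ereal (W m \<omega>))"

definition strictly_stationary :: "'a measure \<Rightarrow> (nat \<Rightarrow> 'a \<Rightarrow> real) \<Rightarrow> bool" where
  "strictly_stationary M W \<longleftrightarrow>
     (\<forall>J h. finite J \<longrightarrow>
        distr M (\<Pi>\<^sub>M j\<in>J. borel) (\<lambda>\<omega>. \<lambda>j\<in>J. W (j + h) \<omega>) =
        distr M (\<Pi>\<^sub>M j\<in>J. borel) (\<lambda>\<omega>. \<lambda>j\<in>J. W j \<omega>))"

text \<open>
  The coefficient $\alpha_{n,l}$. Its index set is empty only if \<open>l + 3 > n\<close>, which for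
  \<open>l = l\<^sub>n = o(n)\<close> excludes just finitely many \<open>n\<close>.
\<close>

definition mixing_coeff ::
    "'a measure \<Rightarrow> (nat \<Rightarrow> 'a \<Rightarrow> real) \<Rightarrow> (nat \<Rightarrow> real) \<Rightarrow> nat \<Rightarrow> nat \<Rightarrow> real" where
  "mixing_coeff M W u n l =
     Sup {\<bar>\<P>(\<omega> in M. max_over W {i..i + a} \<omega> \<le> ereal (u n) \<and> max_over W {j..j + b} \<omega> \<le> ereal (u n))
           - \<P>(\<omega> in M. max_over W {i..i + a} \<omega> \<le> ereal (u n))
             * \<P>(\<omega> in M. max_over W {j..j + b} \<omega> \<le> ereal (u n))\<bar>
          | i a j b. 1 \<le> i \<and> i < i + a + l \<and> i + a + l \<le> j \<and> j < j + b \<and> j + b \<le> n}"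

text \<open>Condition $D(u_n)$ with a specified sequence \<open>l\<close>; $D(u_n)$ itself asks that some \<open>l\<close> exists.\<close>

definition condition_D_with ::
    "'a measure \<Rightarrow> (nat \<Rightarrow> 'a \<Rightarrow> real) \<Rightarrow> (nat \<Rightarrow> real) \<Rightarrow> (nat \<Rightarrow> nat) \<Rightarrow> bool" where
  "condition_D_with M W u l \<longleftrightarrow>
     (\<lambda>n. real (l n)) \<in> o(\<lambda>n. real n) \<and>
     (\<lambda>n. mixing_coeff M W u n (l n)) \<longlonglongrightarrow> 0"

definition condition_D_T ::
    "'a measure \<Rightarrow> (nat \<Rightarrow> 'a \<Rightarrow> real) \<Rightarrow> nat \<Rightarrow> nat \<Rightarrow> (nat \<Rightarrow> real) \<Rightarrow> bool" where
  "condition_D_T M W T s u \<longleftrightarrow>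
     (\<exists>l. condition_D_with M W u l \<and>
       (\<exists>k :: nat \<Rightarrow> nat.
          filterlim k at_top sequentially \<and>
          (\<lambda>n. real (k n) * real (l n) / real n) \<longlonglongrightarrow> 0 \<and>
          (\<lambda>n. real (k n) * mixing_coeff M W u n (l n)) \<longlonglongrightarrow> 0 \<and>
          (\<lambda>n. real n / real T *
              (\<Sum>i=1..T. \<P>(\<omega> in M. W i \<omega> > u n
                  \<and> ereal (u n) \<ge> max_over W {i + 1..i + s - 1} \<omega>
                  \<and> max_over W {i + s..n div (k n * T) * T} \<omega> > ereal (u n)))) \<longlonglongrightarrow> 0))"

text \<open>
  The extremal index along the levels \<open>u\<close> of a \<open>T\<close>-periodic sequence (stationary if \<open>T = 1\<close>),
  where \<open>\<tau>\<close> is the limiting mean number of exceedances. The limit \<open>L\<close> has to be positive for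
  its logarithm to make sense.
\<close>

definition has_extremal_index ::
    "'a measure \<Rightarrow> (nat \<Rightarrow> 'a \<Rightarrow> real) \<Rightarrow> nat \<Rightarrow> (nat \<Rightarrow> real) \<Rightarrow> real \<Rightarrow> real \<Rightarrow> bool" where
  "has_extremal_index M W T u \<tau> \<theta> \<longleftrightarrow>
     0 < \<tau> \<and>
     (\<lambda>n. real n / real T * (\<Sum>j=1..T. \<P>(\<omega> in M. W j \<omega> > u n))) \<longlonglongrightarrow> \<tau> \<and>
     (\<exists>L>0. (\<lambda>n. \<P>(\<omega> in M. max_over W {1..n} \<omega> \<le> ereal (u n))) \<longlonglongrightarrow> L \<and>
            \<theta> = - (1 / \<tau>) * ln L)"

text \<open>Only the terms with index at least 1 are meaningful.\<close>

definition Y_seq ::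
    "nat \<Rightarrow> (nat \<Rightarrow> 'a \<Rightarrow> real) \<Rightarrow> (nat \<Rightarrow> 'a \<Rightarrow> real) \<Rightarrow> nat \<Rightarrow> 'a \<Rightarrow> real" where
  "Y_seq T U X n \<omega> =
     U n \<omega> * X n \<omega>
     + (1 - U n \<omega>) * (MAX i\<in>{(n - 1) div T * T..n - 1}. U i \<omega> * X i \<omega>)"

definition S_mid :: "nat \<Rightarrow> nat \<Rightarrow> nat set" where
  "S_mid T i = {i + 1..T}"

definition S_upper :: "nat \<Rightarrow> nat \<Rightarrow> nat set" where
  "S_upper T i = {T + 1..T + i - 1}"

definition S_lower :: "nat \<Rightarrow> nat set" where
  "S_lower i = {1..i - 1}"

text \<open>The sequence in \<open>n\<close> whose limit is $P^*_{i,T}$, for \<open>1 \<le> i \<le> T - 1\<close>.\<close>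

definition P_star_seq ::
    "'a measure \<Rightarrow> (nat \<Rightarrow> 'a \<Rightarrow> real) \<Rightarrow> (nat \<Rightarrow> real) \<Rightarrow> real \<Rightarrow> nat \<Rightarrow> nat \<Rightarrow> nat \<Rightarrow> real" where
  "P_star_seq M X u p T i n = real n *
     ((\<Sum>I\<in>{I. I \<subset> S_upper T i}.
         \<P>(\<omega> in M. X i \<omega> > u n \<and> max_over X (S_mid T i \<union> I) \<omega> \<le> ereal (u n))
         * p ^ (card I + T - i) * (1 - p) ^ (i - 1 - card I))
      + (\<Sum>J\<in>Pow (S_lower i). \<Sum>I\<in>Pow (S_upper T i).
         \<P>(\<omega> in M. max_over X (J \<union> {0}) \<omega> > ereal (u n)
              \<and> max_over X (S_mid T i \<union> I) \<omega> \<le> ereal (u n))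
         * p ^ (card I + card J + T - i - 1) * (1 - p) ^ (2 * i - 1 - card I - card J)))"

definition P_star ::
    "'a measure \<Rightarrow> (nat \<Rightarrow> 'a \<Rightarrow> real) \<Rightarrow> (nat \<Rightarrow> real) \<Rightarrow> real \<Rightarrow> nat \<Rightarrow> nat \<Rightarrow> real" where
  "P_star M X u p T i = lim (P_star_seq M X u p T i)"

end

theory Submission
  imports Defs
begin

text \<open>
  Let \<open>W\<close> be \<open>T\<close>-periodic and cut \<open>{1..n}\<close> into \<open>k n\<close> blocks whose length is a multiple of \<open>T\<close>. Mixing makes
  \<open>P(M\<^sub>n \<le> u n)\<close> asymptotically the \<open>k n\<close>-th power of the same probability for one block. Counting the
  exceedances of a block that are followed by \<open>s - 1\<close> values below the level (by the anti-clustering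
  condition, there is asymptotically only one such cluster end per block) gives
  \<open>P(M\<^sub>n \<le> u n) - exp (- \<lambda>\<^sub>n) \<rightarrow> 0\<close> with \<open>\<lambda>\<^sub>n = n / T * (\<Sum>i=1..T. P(W\<^sub>i > u n \<ge> M\<^sub>i\<^sub>+\<^sub>1\<^sub>,\<^sub>i\<^sub>+\<^sub>s\<^sub>-\<^sub>1))\<close>.
  This applies with \<open>s = T\<close> both to \<open>X\<close> and to \<open>Y\<close>. After an exceedance every switched-off index of the
  same period repeats the exceedance, so a cluster of \<open>Y\<close> ends at \<open>i\<close> only if all later switches of the
  period are on; summing over the remaining switches expresses \<open>\<lambda>\<^sub>n\<close> of \<open>Y\<close> as \<open>p ^ (T - 1)\<close> times \<open>\<lambda>\<^sub>n\<close> of \<open>X\<close>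
  plus \<open>1 / T\<close> times the sum of the terms \<open>P_star_seq\<close>.
\<close>

subsection \<open>Factorisation over blocks\<close>

text \<open>Void probabilities are compared with exp (- lambda_n) itself, without convergence of
  lambda_n, so the comparison can be read in both directions. For X the extremal index gives the
  limit of the void probabilities and thereby that of lambda_n, which is nowhere assumed to
  converge; for Y, convergence of the P* terms gives lambda_n and thereby the void probabilities. X
  is treated with s = T as well, because a window of T - 1 quiet indices of X is what remains when
  all relevant switches are on. This is also why the first sum in P* runs over proper subsets: the
  full subset has moved into the X term. One hypothesis on X controls the late exceedances of both
  sequences, since an exceedance of Y always stems from one of X in the same period. The remaining
  obstacle is quantitative: remainders and block edges cost a multiple of k n indices, each of
  probability O(1/n). Hence k n = o(n) is needed, and for gap zero it has to be extracted from
  mixing.\<close>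

lemma max_over_le_iff: "max_over W B \<omega> \<le> ereal x \<longleftrightarrow> (\<forall>m\<in>B. W m \<omega> \<le> x)"
  by (simp add: max_over_def SUP_le_iff)

lemma less_max_over_iff: "ereal x < max_over W B \<omega> \<longleftrightarrow> (\<exists>m\<in>B. x < W m \<omega>)"
  by (simp add: max_over_def less_SUP_iff)

lemmas max_over_iffs = max_over_le_iff less_max_over_iff

context prob_space
begin

text \<open>A real supremum bounds its elements only when the set is bounded above; here 1 is a
  bound, as probabilities and their products lie between 0 and 1.\<close>

lemma mixing_coeff_bound:
  assumes "1 \<le> i" "i < i + a + l" "i + a + l \<le> j" "j < j + b" "j + b \<le> n"
  shows "\<bar>\<P>(\<omega> in M. (\<forall>m\<in>{i..i+a}. W m \<omega> \<le> u n) \<and> (\<forall>m\<in>{j..j+b}. W m \<omega> \<le> u n))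
     - \<P>(\<omega> in M. \<forall>m\<in>{i..i+a}. W m \<omega> \<le> u n) * \<P>(\<omega> in M. \<forall>m\<in>{j..j+b}. W m \<omega> \<le> u n)\<bar>
     \<le> mixing_coeff M W u n l"
  unfolding mixing_coeff_def max_over_le_iff
proof (rule cSup_upper)
  have *: "\<bar>prob A - prob B * prob C\<bar> \<le> 1" for A B C
  proof -
    have "prob B * prob C \<le> 1" by (simp add: mult_le_one)
    then show ?thesis using measure_nonneg[of M A] prob_le_1[of A]
      mult_nonneg_nonneg[OF measure_nonneg[of M B] measure_nonneg[of M C]] by linarith
  qed
  show "bdd_above {\<bar>\<P>(\<omega> in M. (\<forall>m\<in>{i..i+a}. W m \<omega> \<le> u n) \<and> (\<forall>m\<in>{j..j+b}. W m \<omega> \<le> u n))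
     - \<P>(\<omega> in M. \<forall>m\<in>{i..i+a}. W m \<omega> \<le> u n) * \<P>(\<omega> in M. \<forall>m\<in>{j..j+b}. W m \<omega> \<le> u n)\<bar>
     |i a j b. 1 \<le> i \<and> i < i + a + l \<and> i + a + l \<le> j \<and> j < j + b \<and> j + b \<le> n}"
    by (rule bdd_aboveI[where M=1]) (use * in blast)
qed (use assms in blast)

text \<open>Only exceedance patterns over finite index sets are compared. Such a pattern takes
  finitely many values, so \<open>Q\<close> can be arbitrary, and the events below are obtained by
  choosing \<open>Q\<close>. Index 0 is left out because \<open>n - 1\<close> truncates there:
  \<open>Y_seq\<close> at 0 does not look back into a previous period, as it does at every later
  multiple of \<open>T\<close>.\<close>

definition threshold_periodic :: "(nat \<Rightarrow> 'a \<Rightarrow> real) \<Rightarrow> nat \<Rightarrow> real \<Rightarrow> bool" where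
  "threshold_periodic W T v \<longleftrightarrow> (\<forall>J c Q. finite J \<longrightarrow> 0 \<notin> J \<longrightarrow>
     \<P>(\<omega> in M. Q {j\<in>J. v < W (j + c * T) \<omega>}) = \<P>(\<omega> in M. Q {j\<in>J. v < W j \<omega>}))"

lemma threshold_periodicD:
  "threshold_periodic W T v \<Longrightarrow> finite J \<Longrightarrow> 0 \<notin> J \<Longrightarrow>
     \<P>(\<omega> in M. Q {j\<in>J. v < W (j + c * T) \<omega>}) = \<P>(\<omega> in M. Q {j\<in>J. v < W j \<omega>})"
  unfolding threshold_periodic_def by blast

lemma threshold_periodic_block:
  assumes "threshold_periodic W T v"
  shows "\<P>(\<omega> in M. \<forall>j\<in>{c * T + 1..c * T + r}. W j \<omega> \<le> v) = \<P>(\<omega> in M. \<forall>j\<in>{1..r}. W j \<omega> \<le> v)"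
proof -
  have "(\<forall>j\<in>{c * T + 1..c * T + r}. W j \<omega> \<le> v) \<longleftrightarrow> {j\<in>{1..r}. v < W (j + c * T) \<omega>} = {}" for \<omega>
  proof -
    have "{c * T + 1..c * T + r} = (\<lambda>j. j + c * T) ` {1..r}" by (simp add: add.commute)
    then show ?thesis by (simp add: not_less del: image_add_atLeastAtMost' image_add_atLeastAtMost) auto
  qed
  moreover have "(\<forall>j\<in>{1..r}. W j \<omega> \<le> v) \<longleftrightarrow> {j\<in>{1..r}. v < W j \<omega>} = {}" for \<omega>
    by (auto simp: not_less)
  ultimately show ?thesis
    using threshold_periodicD[OF assms, where J = "{1..r}" and c = c and Q = "\<lambda>S. S = {}"] by simp
qed

lemma threshold_periodic_single:
  assumes "threshold_periodic W T v" "1 \<le> j"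
  shows "\<P>(\<omega> in M. v < W (j + c * T) \<omega>) = \<P>(\<omega> in M. v < W j \<omega>)"
  using threshold_periodicD[OF assms(1), of "{j}" "\<lambda>S. j \<in> S" c] assms(2) by simp

lemma residue_representative:
  assumes "1 \<le> (T::nat)" "1 \<le> j"
  obtains i c where "i \<in> {1..T}" "j = i + c * T"
proof
  show "(j - 1) mod T + 1 \<in> {1..T}" using assms by (simp add: Suc_leI)
  show "j = ((j - 1) mod T + 1) + (j - 1) div T * T" using assms by simp
qed

text \<open>The error terms need one constant for all indices. The sum over a period serves, and
  \<open>n\<close> times this sum will converge.\<close>

lemma exceedance_bound:
  assumes per: "threshold_periodic W T v" and "1 \<le> T" "1 \<le> j"
  shows "\<P>(\<omega> in M. v < W j \<omega>) \<le> (\<Sum>i=1..T. \<P>(\<omega> in M. v < W i \<omega>))"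
proof -
  obtain i c where ic: "i \<in> {1..T}" "j = i + c * T"
    using residue_representative[OF assms(2,3)] .
  have "\<P>(\<omega> in M. v < W j \<omega>) = \<P>(\<omega> in M. v < W i \<omega>)"
    using ic threshold_periodic_single[OF per] by simp
  also have "\<dots> \<le> (\<Sum>i=1..T. \<P>(\<omega> in M. v < W i \<omega>))"
    using ic by (intro member_le_sum) auto
  finally show ?thesis .
qed

text \<open>Union bound over the dropped indices. It opens the gap of \<open>l\<close> indices
  between neighbouring blocks, discards the remainder after the last full block and, with
  \<open>A = {}\<close>, bounds the probability of an exceedance in a block.\<close>

lemma drop_indices:
  fixes W :: "nat \<Rightarrow> 'a \<Rightarrow> real"
  assumes meas: "\<And>n. W n \<in> borel_measurable M" and "finite A" "finite B" "finite D"
    and c: "\<And>j. j \<in> D \<Longrightarrow> \<P>(\<omega> in M. v < W j \<omega>) \<le> c"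
    and "A \<subseteq> B" "B \<subseteq> A \<union> D"
  shows "\<P>(\<omega> in M. \<forall>j\<in>B. W j \<omega> \<le> v) \<le> \<P>(\<omega> in M. \<forall>j\<in>A. W j \<omega> \<le> v)"
    and "\<P>(\<omega> in M. \<forall>j\<in>A. W j \<omega> \<le> v) \<le> \<P>(\<omega> in M. \<forall>j\<in>B. W j \<omega> \<le> v) + real (card D) * c"
proof -
  note [measurable] = meas
  note [simp] = assms(2-4)
  show "\<P>(\<omega> in M. \<forall>j\<in>B. W j \<omega> \<le> v) \<le> \<P>(\<omega> in M. \<forall>j\<in>A. W j \<omega> \<le> v)"
  proof (rule finite_measure_mono)
    show "{\<omega> \<in> space M. \<forall>j\<in>B. W j \<omega> \<le> v} \<subseteq> {\<omega> \<in> space M. \<forall>j\<in>A. W j \<omega> \<le> v}"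
      using \<open>A \<subseteq> B\<close> by blast
  qed measurable
  have "\<P>(\<omega> in M. \<forall>j\<in>A. W j \<omega> \<le> v)
      \<le> prob ({\<omega> \<in> space M. \<forall>j\<in>B. W j \<omega> \<le> v} \<union> (\<Union>j\<in>D. {\<omega> \<in> space M. v < W j \<omega>}))"
    using \<open>B \<subseteq> A \<union> D\<close>
    by (intro finite_measure_mono subsetI) (auto simp: not_less[symmetric])
  also have "\<dots> \<le> \<P>(\<omega> in M. \<forall>j\<in>B. W j \<omega> \<le> v) + prob (\<Union>j\<in>D. {\<omega> \<in> space M. v < W j \<omega>})"
    by (intro measure_Un_le) auto
  also have "prob (\<Union>j\<in>D. {\<omega> \<in> space M. v < W j \<omega>}) \<le> (\<Sum>j\<in>D. \<P>(\<omega> in M. v < W j \<omega>))"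
    by (intro finite_measure_subadditive_finite) auto
  also have "\<dots> \<le> real (card D) * c" using sum_bounded_above[of D "\<lambda>j. \<P>(\<omega> in M. v < W j \<omega>)" c] c by simp
  finally show "\<P>(\<omega> in M. \<forall>j\<in>A. W j \<omega> \<le> v) \<le> \<P>(\<omega> in M. \<forall>j\<in>B. W j \<omega> \<le> v) + real (card D) * c"
    by simp
qed

text \<open>\<open>Q b\<close> will be the void probability of the first \<open>b\<close> blocks.
  One more block costs \<open>e\<close>, and multiplication by \<open>Q 1 \<le> 1\<close> does not
  enlarge the error made so far, so the errors merely add up.\<close>

lemma telescoped_product_bound:
  fixes Q :: "nat \<Rightarrow> real"
  assumes "\<And>b. 1 \<le> b \<Longrightarrow> b < k \<Longrightarrow> \<bar>Q (Suc b) - Q b * Q 1\<bar> \<le> e" "0 \<le> Q 1" "Q 1 \<le> 1" "0 \<le> e" "1 \<le> b" "b \<le> k"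
  shows "\<bar>Q b - Q 1 ^ b\<bar> \<le> real b * e"
  using assms(5,6)
proof (induction b rule: nat_induct_at_least)
  case base then show ?case using assms(4) by simp
next
  case (Suc b)
  have 1: "\<bar>Q b - Q 1 ^ b\<bar> \<le> real b * e" using Suc by simp
  have "Q (Suc b) - Q 1 ^ Suc b = (Q (Suc b) - Q b * Q 1) + Q 1 * (Q b - Q 1 ^ b)"
    by (simp add: algebra_simps)
  then have "\<bar>Q (Suc b) - Q 1 ^ Suc b\<bar> \<le> \<bar>Q (Suc b) - Q b * Q 1\<bar> + \<bar>Q 1 * (Q b - Q 1 ^ b)\<bar>" by linarith
  also have "\<dots> \<le> e + \<bar>Q b - Q 1 ^ b\<bar>"
    using assms(1)[of b] Suc mult_left_le_one_le[of "\<bar>Q b - Q 1 ^ b\<bar>" "Q 1"] assms(2,3)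
    by (simp add: abs_mult)
  finally show ?case using 1 by (simp add: algebra_simps)
qed

text \<open>Blocks are split off one at a time. Deleting the last \<open>l\<close> indices before
  the new block makes mixing applicable; restoring them costs \<open>l * c\<close> in the joint
  probability and once more in the product, hence \<open>2 * real l * c\<close> per block.\<close>

lemma block_factorisation:
  assumes meas: "\<And>n. W n \<in> borel_measurable M"
    and per: "threshold_periodic W T (u n)" and T: "1 \<le> T"
    and r: "r = q * T" "2 \<le> r" "l < r" "k * r \<le> n" "2 \<le> k"
    and c: "\<And>j. 1 \<le> j \<Longrightarrow> \<P>(\<omega> in M. u n < W j \<omega>) \<le> c" "0 \<le> c"
  shows "\<bar>\<P>(\<omega> in M. \<forall>j\<in>{1..k*r}. W j \<omega> \<le> u n) - \<P>(\<omega> in M. \<forall>j\<in>{1..r}. W j \<omega> \<le> u n) ^ k\<bar>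
     \<le> real k * (mixing_coeff M W u n l + 2 * real l * c)"
proof -
  define Q where "Q b = \<P>(\<omega> in M. \<forall>j\<in>{1..b*r}. W j \<omega> \<le> u n)" for b
  have step: "\<bar>Q (Suc b) - Q b * Q 1\<bar> \<le> mixing_coeff M W u n l + 2 * real l * c" if b: "1 \<le> b" "b < k" for b
  proof -
    have br: "r \<le> b * r" using b by simp
    have "Suc b * r \<le> k * r" using b by (intro mult_right_mono) auto
    then have brn: "b * r + r \<le> n" using r by simp
    have b1: "1 + (b*r - l - 1) = b*r - l" using br r by linarith
    have b2: "b*r + 1 + (r - 1) = b*r + r" using r by linarith
    let ?A = "{1..b*r-l}" and ?B = "{b*r+1..b*r+r}" and ?D = "{b*r-l+1..b*r}"
    let ?P = "\<lambda>A. \<P>(\<omega> in M. \<forall>j\<in>A. W j \<omega> \<le> u n)"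
    have "\<bar>\<P>(\<omega> in M. (\<forall>j\<in>?A. W j \<omega> \<le> u n) \<and> (\<forall>j\<in>?B. W j \<omega> \<le> u n)) - ?P ?A * ?P ?B\<bar>
      \<le> mixing_coeff M W u n l"
      using mixing_coeff_bound[of 1 "b*r-l-1" l "b*r+1" "r-1" n W u, unfolded b1 b2] br brn r(2-) b
      by (simp del: One_nat_def)
    also have "?P ?B = Q 1" unfolding Q_def using threshold_periodic_block[OF per, of "b*q" r] r(1)
      by (simp add: mult.assoc)
    also have "\<P>(\<omega> in M. (\<forall>j\<in>?A. W j \<omega> \<le> u n) \<and> (\<forall>j\<in>?B. W j \<omega> \<le> u n)) = ?P (?A \<union> ?B)"
      by (simp add: ball_Un)
    finally have 1: "\<bar>?P (?A \<union> ?B) - ?P ?A * Q 1\<bar> \<le> mixing_coeff M W u n l" .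
    have D: "card ?D = l" using br \<open>l < r\<close> diff_diff_cancel[OF order_trans[OF less_imp_le[OF \<open>l < r\<close>] br]] by simp
    have cD: "j \<in> ?D \<Longrightarrow> \<P>(\<omega> in M. u n < W j \<omega>) \<le> c" for j using c by simp
    have "?A \<union> ?B \<subseteq> {1..Suc b*r}" "{1..Suc b*r} \<subseteq> (?A \<union> ?B) \<union> ?D" by auto
    then have 2: "Q (Suc b) \<le> ?P (?A \<union> ?B)" "?P (?A \<union> ?B) \<le> Q (Suc b) + real l * c"
      unfolding Q_def
      using drop_indices[where W = W and A = "?A \<union> ?B" and B = "{1..Suc b*r}" and D = ?D, OF meas _ _ _ cD, unfolded D]
      by simp_all
    have "?A \<subseteq> {1..b*r}" "{1..b*r} \<subseteq> ?A \<union> ?D" by auto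
    then have "Q b \<le> ?P ?A" "?P ?A \<le> Q b + real l * c"
      unfolding Q_def
      using drop_indices[where W = W and A = ?A and B = "{1..b*r}" and D = ?D, OF meas _ _ _ cD, unfolded D]
      by simp_all
    moreover have Q1: "0 \<le> Q 1" "Q 1 \<le> 1" unfolding Q_def by auto
    ultimately have "\<bar>?P ?A * Q 1 - Q b * Q 1\<bar> \<le> real l * c"
      using mult_mono[of "?P ?A - Q b" "real l * c" "Q 1" 1]
      by (simp add: left_diff_distrib[symmetric] abs_mult)
    then show ?thesis using 1 2 by linarith
  qed
  \<comment> \<open>The telescoping needs a nonnegative error. \<open>mixing_coeff\<close> is a
    supremum of a possibly empty set, so the sign is read off from the step bound at
    \<open>b = 1\<close>, which \<open>2 \<le> k\<close> makes available.\<close>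
  have "0 \<le> mixing_coeff M W u n l + 2 * real l * c"
    using step[of 1] r(5) abs_ge_zero[of "Q (Suc 1) - Q 1 * Q 1"] by linarith
  then show ?thesis
    using telescoped_product_bound[of k Q, OF step] r(5) unfolding Q_def by simp
qed

section \<open>Counting cluster ends inside one block\<close>

lemma sum_residues_le:
  fixes f F :: "nat \<Rightarrow> real"
  assumes "\<And>i c. i \<in> {1..T} \<Longrightarrow> f (i + c * T) \<le> F i"
  shows "(\<Sum>i=1..q * T. f i) \<le> real q * (\<Sum>i=1..T. F i)"
proof (induction q)
  case (Suc q)
  have "(\<Sum>i=1..Suc q * T. f i) = (\<Sum>i=1..q * T. f i) + (\<Sum>i=1+q*T..T+q*T. f i)"
    using sum.ub_add_nat[of 1 "q*T" f T] by (simp add: add.commute)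
  also have "(\<Sum>i=1+q*T..T+q*T. f i) = (\<Sum>i=1..T. f (i + q*T))"
    by (rule sum.shift_bounds_cl_nat_ivl)
  also have "\<dots> \<le> (\<Sum>i=1..T. F i)" by (intro sum_mono assms)
  finally show ?case using Suc by (simp add: algebra_simps)
qed simp

text \<open>The event is split according to the last index \<open>i\<close> that exceeds the level.
  Being last and being followed by \<open>s - 1\<close> quiet values differ in two cases only: there
  is another exceedance inside the block at distance at least \<open>s\<close> (the sum on the
  right), or the window of \<open>i\<close> sticks out beyond \<open>r\<close>. The second case
  concerns fewer than \<open>s\<close> indices and is paid for by \<open>real s * c\<close>.\<close>

lemma cluster_count:
  assumes meas: "\<And>n. W n \<in> borel_measurable M"
    and per: "threshold_periodic W T v" and s: "1 \<le> s"
    and r: "r = q * T"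
    and c: "\<And>j. 1 \<le> j \<Longrightarrow> \<P>(\<omega> in M. v < W j \<omega>) \<le> c" "0 \<le> c"
  shows "\<bar>\<P>(\<omega> in M. \<exists>j\<in>{1..r}. v < W j \<omega>)
       - real q * (\<Sum>i=1..T. \<P>(\<omega> in M. v < W i \<omega> \<and> (\<forall>j\<in>{i+1..i+s-1}. W j \<omega> \<le> v)))\<bar>
     \<le> real q * (\<Sum>i=1..T. \<P>(\<omega> in M. v < W i \<omega> \<and> (\<forall>j\<in>{i+1..i+s-1}. W j \<omega> \<le> v) \<and> (\<exists>j\<in>{i+s..r}. v < W j \<omega>)))
       + real s * c"
proof -
  note [measurable] = meas
  define E where "E i = {\<omega> \<in> space M. v < W i \<omega> \<and> (\<forall>j\<in>{i+1..r}. W j \<omega> \<le> v)}" for i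
  define g where "g i = \<P>(\<omega> in M. v < W i \<omega> \<and> (\<forall>j\<in>{i+1..i+s-1}. W j \<omega> \<le> v))" for i
  define h where "h i m = \<P>(\<omega> in M. v < W i \<omega> \<and> (\<forall>j\<in>{i+1..i+s-1}. W j \<omega> \<le> v) \<and> (\<exists>j\<in>{i+s..m}. v < W j \<omega>))" for i m
  have E[measurable]: "E i \<in> events" for i unfolding E_def by measurable
  have disj: "E i \<inter> E j = {}" if "i < j" "j \<le> r" for i j
  proof -
    have "j \<in> {i+1..r}" using that by simp
    then show ?thesis unfolding E_def by (auto simp: not_less[symmetric])
  qed
  have "{\<omega> \<in> space M. \<exists>j\<in>{1..r}. v < W j \<omega>} = (\<Union>i\<in>{1..r}. E i)"
  proof (intro equalityI subsetI)
    fix \<omega> assume w: "\<omega> \<in> {\<omega> \<in> space M. \<exists>j\<in>{1..r}. v < W j \<omega>}"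
    let ?S = "{j\<in>{1..r}. v < W j \<omega>}"
    have m: "finite ?S" "?S \<noteq> {}" using w by auto
    have "W j \<omega> \<le> v" if "j \<in> {Max ?S + 1..r}" for j
    proof (rule ccontr)
      assume "\<not> W j \<omega> \<le> v"
      then have "j \<in> ?S" using that by simp
      then have "j \<le> Max ?S" by (rule Max_ge[OF m(1)])
      then show False using that by simp
    qed
    then have "\<omega> \<in> E (Max ?S)"
      unfolding E_def using w Max_in[OF m] by blast
    then show "\<omega> \<in> (\<Union>i\<in>{1..r}. E i)" using Max_in[OF m] by auto
  qed (auto simp: E_def)
  moreover have "disjoint_family_on E {1..r}"
    unfolding disjoint_family_on_def
    by (metis atLeastAtMost_iff disj inf_commute linorder_neqE_nat)
  ultimately have PE: "\<P>(\<omega> in M. \<exists>j\<in>{1..r}. v < W j \<omega>) = (\<Sum>i=1..r. prob (E i))"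
    by (simp add: finite_measure_finite_Union image_subset_iff)
  let ?e = "\<lambda>i. if r < i + s - 1 then c else 0"
  have close: "\<bar>prob (E i) - g i\<bar> \<le> h i r + ?e i" if i: "1 \<le> i" for i
  proof (cases "r < i + s - 1")
    case True
    have "g i \<le> prob (E i)" unfolding g_def E_def using True
      by (intro finite_measure_mono subsetI) auto
    moreover have "prob (E i) \<le> \<P>(\<omega> in M. v < W i \<omega>)" unfolding E_def
      by (intro finite_measure_mono subsetI) auto
    moreover have "0 \<le> g i" "0 \<le> h i r" unfolding g_def h_def by simp_all
    ultimately show ?thesis using c(1)[OF i] True by simp
  next
    case False
    have "prob (E i) \<le> g i" unfolding g_def E_def using False
      by (intro finite_measure_mono subsetI) auto
    moreover have "g i \<le> prob (E i \<union> {\<omega>\<in>space M. v < W i \<omega> \<and> (\<forall>j\<in>{i+1..i+s-1}. W j \<omega> \<le> v) \<and> (\<exists>j\<in>{i+s..r}. v < W j \<omega>)})"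
      unfolding g_def
    proof (rule finite_measure_mono)
      have "{i+1..r} \<subseteq> {i+1..i+s-1} \<union> {i+s..r}" by auto
      then show "{\<omega>\<in>space M. v < W i \<omega> \<and> (\<forall>j\<in>{i+1..i+s-1}. W j \<omega> \<le> v)} \<subseteq> E i \<union>
         {\<omega>\<in>space M. v < W i \<omega> \<and> (\<forall>j\<in>{i+1..i+s-1}. W j \<omega> \<le> v) \<and> (\<exists>j\<in>{i+s..r}. v < W j \<omega>)}"
        unfolding E_def by (fastforce simp: not_less[symmetric])
    qed measurable
    moreover have "\<dots> \<le> prob (E i) + h i r" unfolding h_def by (intro measure_Un_le) auto
    ultimately show ?thesis using False by simp
  qed
  have geq: "g (i + d * T) = g i" if "i \<in> {1..T}" for i d
  proof -
    \<comment> \<open>To apply \<open>threshold_periodicD\<close> the event has to be a property of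
      the exceedance pattern on a fixed index set: the pattern on \<open>{i..i+s-1}\<close> is
      exactly \<open>{i}\<close>. The case \<open>a = 0\<close> is the unshifted event.\<close>
    have 1: "(v < W (i+a) \<omega> \<and> (\<forall>j\<in>{i+a+1..i+a+s-1}. W j \<omega> \<le> v)) \<longleftrightarrow> {j\<in>{i..i+s-1}. v < W (j+a) \<omega>} = {i}" for a \<omega>
    proof -
      have "(\<forall>j\<in>{i+a+1..i+a+s-1}. W j \<omega> \<le> v) \<longleftrightarrow> (\<forall>j\<in>{i+1..i+s-1}. W (j+a) \<omega> \<le> v)"
      proof -
        have sh: "{i+a+1..i+a+s-1} = (\<lambda>j. j + a) ` {i+1..i+s-1}"
          using s by (cases s) (simp_all add: ac_simps)
        show ?thesis unfolding sh by blast
      qed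
      moreover have "{i..i+s-1} = insert i {i+1..i+s-1}" using s by auto
      ultimately show ?thesis by (auto simp: not_less[symmetric])
    qed
    show ?thesis
      unfolding g_def 1 using 1[of 0] threshold_periodicD[OF per, of "{i..i+s-1}" "\<lambda>S. S = {i}" d] that by simp
  qed
  have hle: "h (i + d * T) r \<le> h i r" if "i \<in> {1..T}" for i d
  proof -
    \<comment> \<open>The index set \<open>{i..i+s+r}\<close> is large enough to contain both
      windows however \<open>i + s\<close> and \<open>r\<close> compare. The right end moves with
      the shift.\<close>
    have 1: "(v < W (i+a) \<omega> \<and> (\<forall>j\<in>{i+a+1..i+a+s-1}. W j \<omega> \<le> v) \<and> (\<exists>j\<in>{i+a+s..r+a}. v < W j \<omega>)) \<longleftrightarrow>
      (\<lambda>S. i \<in> S \<and> S \<inter> {i+1..i+s-1} = {} \<and> S \<inter> {i+s..r} \<noteq> {}) {j\<in>{i..i+s+r}. v < W (j+a) \<omega>}" for a \<omega>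
    proof -
      have "(\<forall>j\<in>{i+a+1..i+a+s-1}. W j \<omega> \<le> v) \<longleftrightarrow> (\<forall>j\<in>{i+1..i+s-1}. W (j+a) \<omega> \<le> v)"
      proof -
        have sh: "{i+a+1..i+a+s-1} = (\<lambda>j. j + a) ` {i+1..i+s-1}"
          using s by (cases s) (simp_all add: ac_simps)
        show ?thesis unfolding sh by blast
      qed
      moreover have "(\<exists>j\<in>{i+a+s..r+a}. v < W j \<omega>) \<longleftrightarrow> (\<exists>j\<in>{i+s..r}. v < W (j+a) \<omega>)"
      proof -
        have sh: "{i+a+s..r+a} = (\<lambda>j. j + a) ` {i+s..r}"
          by (simp add: add.commute add.left_commute)
        show ?thesis unfolding sh by blast
      qed
      moreover have sub: "{i+1..i+s-1} \<subseteq> {i..i+s+r}" "{i+s..r} \<subseteq> {i..i+s+r}" by auto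
      moreover have "{j\<in>{i..i+s+r}. v < W (j+a) \<omega>} \<inter> {i+1..i+s-1} = {} \<longleftrightarrow> (\<forall>j\<in>{i+1..i+s-1}. W (j+a) \<omega> \<le> v)"
        using sub(1) unfolding not_less[symmetric] by blast
      moreover have "{j\<in>{i..i+s+r}. v < W (j+a) \<omega>} \<inter> {i+s..r} \<noteq> {} \<longleftrightarrow> (\<exists>j\<in>{i+s..r}. v < W (j+a) \<omega>)"
        using sub(2) by blast
      moreover have "i \<in> {j\<in>{i..i+s+r}. v < W (j+a) \<omega>} \<longleftrightarrow> v < W (i+a) \<omega>" by simp
      ultimately show ?thesis by blast
    qed
    \<comment> \<open>Moving \<open>i\<close> alone shortens the range of late exceedances, so only
      an inequality is available: the end is first extended by the same shift, and then periodicity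
      applies.\<close>
    have "h (i + d*T) r \<le> h (i + d*T) (r + d*T)" unfolding h_def
      by (intro finite_measure_mono subsetI) auto
    also have "\<dots> = h i r"
      unfolding h_def 1 using 1[of 0] threshold_periodicD[OF per, of "{i..i+s+r}" "\<lambda>S. i \<in> S \<and> S \<inter> {i+1..i+s-1} = {} \<and> S \<inter> {i+s..r} \<noteq> {}" d] that by simp
    finally show ?thesis .
  qed
  \<comment> \<open>The one-sided bound, applied to \<open>g\<close> and to its negative, gives an
    equality because \<open>g\<close> is periodic.\<close>
  have gsum: "(\<Sum>i=1..r. g i) = real q * (\<Sum>i=1..T. g i)"
    using sum_residues_le[of T g g q] sum_residues_le[of T "\<lambda>i. - g i" "\<lambda>i. - g i" q] geq
    unfolding r by (simp add: sum_negf)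
  have hsum: "(\<Sum>i=1..r. h i r) \<le> real q * (\<Sum>i=1..T. h i r)"
    using sum_residues_le[of T "\<lambda>i. h i r" "\<lambda>i. h i r" q] hle unfolding r by simp
  have esum: "(\<Sum>i=1..r. ?e i) \<le> real s * c"
  proof -
    have "(\<Sum>i=1..r. ?e i) = real (card {i\<in>{1..r}. r < i + s - 1}) * c"
      by (simp add: sum.If_cases Int_def)
    also have "card {i\<in>{1..r}. r < i + s - 1} \<le> card {r+2-s..r}"
      by (intro card_mono) auto
    also have "card {r+2-s..r} \<le> s" using s by simp
    finally show ?thesis using c(2) by (simp add: mult_right_mono)
  qed
  have "\<bar>(\<Sum>i=1..r. prob (E i)) - (\<Sum>i=1..r. g i)\<bar> \<le> (\<Sum>i=1..r. \<bar>prob (E i) - g i\<bar>)"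
    unfolding sum_subtractf[symmetric] by (rule sum_abs)
  also have "\<dots> \<le> (\<Sum>i=1..r. h i r + ?e i)" by (intro sum_mono close) simp
  also have "\<dots> \<le> real q * (\<Sum>i=1..T. h i r) + real s * c"
    using hsum esum by (simp add: sum.distrib)
  finally show ?thesis unfolding PE gsum unfolding g_def h_def .
qed

end

subsection \<open>The void probability\<close>

text \<open>The upper estimate goes through exp(-y) \<le> 1/(1+y) \<le> 1 - y + y^2, where the last
  inequality holds because (1 - y + y^2)(1 + y) = 1 + y^3.\<close>

lemma exp_minus_linear_error:
  fixes y :: real
  assumes "0 \<le> y"
  shows "\<bar>1 - y - exp (- y)\<bar> \<le> y\<^sup>2"
proof -
  have "1 - y \<le> exp (- y)" using exp_ge_add_one_self[of "- y"] by simp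
  moreover have "exp (- y) \<le> 1 / (1 + y)"
    using exp_ge_add_one_self[of y] assms by (simp add: exp_minus field_simps)
  moreover have "1 / (1 + y) \<le> 1 - y + y\<^sup>2"
  proof -
    have "1 \<le> (1 - y + y\<^sup>2) * (1 + y)"
      using assms by (simp add: algebra_simps power2_eq_square)
    then show ?thesis using assms by (simp add: pos_divide_le_eq)
  qed
  ultimately show ?thesis by linarith
qed

lemma exp_uminus_lipschitz:
  fixes x y :: real
  assumes "0 \<le> x" "0 \<le> y"
  shows "\<bar>exp (- x) - exp (- y)\<bar> \<le> \<bar>x - y\<bar>"
proof -
  have *: "\<bar>exp (- x) - exp (- y)\<bar> \<le> \<bar>x - y\<bar>" if "0 \<le> x" "x \<le> y" for x y :: real
  proof -
    have "exp (- x) - exp (- y) = exp (- x) * (1 - exp (- (y - x)))"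
      by (simp add: algebra_simps exp_add[symmetric])
    also have "\<dots> \<le> 1 * (y - x)"
      using that exp_ge_add_one_self[of "x - y"] by (intro mult_mono) (auto simp del: exp_ge_add_one_self)
    finally show ?thesis using that by simp
  qed
  show ?thesis using *[of x y] *[of y x] assms by (cases "x \<le> y") (auto simp: abs_minus_commute)
qed

text \<open>The exponential is itself a \<open>k\<close>-th power, of exp(-(1-a)). Both bases lie in
  [0,1], so their \<open>k\<close>-th powers differ by at most \<open>k\<close> times the difference
  of the bases, which is quadratic in \<open>1 - a\<close>.\<close>

lemma power_exp_approx:
  fixes a :: real
  assumes "0 \<le> a" "a \<le> 1"
  shows "\<bar>a ^ k - exp (- (real k * (1 - a)))\<bar> \<le> real k * (1 - a)\<^sup>2"
proof -
  have "exp (- (real k * (1 - a))) = exp (- (1 - a)) ^ k"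
    by (simp add: exp_of_nat_mult[symmetric] algebra_simps)
  then have "\<bar>a ^ k - exp (- (real k * (1 - a)))\<bar> \<le> real k * \<bar>a - exp (- (1 - a))\<bar>"
    using norm_power_diff[of a "exp (- (1 - a))" k] assms by simp
  also have "\<dots> \<le> real k * (1 - a)\<^sup>2"
    using exp_minus_linear_error[of "1 - a"] assms by (intro mult_left_mono) auto
  finally show ?thesis .
qed

context prob_space
begin

text \<open>Origin of the error terms: the factorisation over blocks gives
  \<open>k * mixing_coeff\<close> and \<open>2 * l * k * c\<close>; the fewer than
  \<open>k * T\<close> indices after the last block give \<open>T * k * c\<close>; counting cluster
  ends gives \<open>n / T * h\<close> and \<open>s * k * c\<close>; replacing \<open>k * q\<close>
  by \<open>n / T\<close> gives \<open>k * c\<close>; passing from the power to the exponential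
  gives the term with \<open>1 / k\<close>.\<close>

lemma void_probability_estimate:
  fixes W :: "nat \<Rightarrow> 'a \<Rightarrow> real" and u :: "nat \<Rightarrow> real" and T s l k n :: nat
  defines "c \<equiv> \<Sum>i=1..T. \<P>(\<omega> in M. u n < W i \<omega>)"
    and "g \<equiv> \<Sum>i=1..T. \<P>(\<omega> in M. u n < W i \<omega> \<and> (\<forall>j\<in>{i+1..i+s-1}. W j \<omega> \<le> u n))"
    and "h \<equiv> \<Sum>i=1..T. \<P>(\<omega> in M. u n < W i \<omega> \<and> (\<forall>j\<in>{i+1..i+s-1}. W j \<omega> \<le> u n)
                  \<and> (\<exists>j\<in>{i+s..n div (k * T) * T}. u n < W j \<omega>))"
  assumes meas: "\<And>n. W n \<in> borel_measurable M"
    and per: "threshold_periodic W T (u n)" and T: "1 \<le> T" and s: "1 \<le> s"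
    and k: "2 \<le> k" "4 * (k * T) \<le> n" "2 * (k * l) \<le> n"
  shows "\<bar>\<P>(\<omega> in M. \<forall>j\<in>{1..n}. W j \<omega> \<le> u n) - exp (- (real n / real T * g))\<bar>
    \<le> real k * mixing_coeff M W u n l + real n / real T * h
      + (real T + real s + 1 + 2 * real l) * (real k * c) + (real n * c)\<^sup>2 / real k"
proof -
  note [measurable] = meas
  define q where "q = n div (k * T)"
  define r where "r = q * T"
  let ?P = "\<lambda>A. \<P>(\<omega> in M. \<forall>j\<in>A. W j \<omega> \<le> u n)"
  have kT: "0 < k * T" using k T by simp
  have "4 \<le> q" unfolding q_def using k(2) kT by (simp add: less_eq_div_iff_mult_less_eq)
  have krn: "k * r \<le> n" unfolding r_def q_def
    by (metis div_times_less_eq_dividend mult.left_commute)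
  have nkr: "n < k * r + k * T"
    using dividend_less_div_times[OF kT, of n] unfolding r_def q_def by (simp add: algebra_simps)
  have "4 \<le> r" unfolding r_def using \<open>4 \<le> q\<close> T mult_le_mono[of 4 q 1 T] by simp
  \<comment> \<open>Rounding loses less than \<open>k * T\<close>, at most a quarter of
    \<open>n\<close>, so \<open>k * r\<close> exceeds three quarters of \<open>n\<close>, whereas
    \<open>k * l\<close> is at most half of it.\<close>
  have "l < r"
  proof -
    have "4 * (k * l) \<le> 2 * n" using k by linarith
    also have "2 * n < 4 * (k * r)" using nkr k(2) kT by linarith
    finally show ?thesis using k by simp
  qed
  have c: "\<P>(\<omega> in M. u n < W j \<omega>) \<le> c" if "1 \<le> j" for j
    unfolding c_def by (rule exceedance_bound[OF per T that])
  have c0: "0 \<le> c" unfolding c_def by (intro sum_nonneg) simp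
  have g: "0 \<le> g" "g \<le> c" unfolding g_def c_def
    by (intro sum_nonneg, simp, intro sum_mono finite_measure_mono, auto)
  have h0: "0 \<le> h" unfolding h_def by (intro sum_nonneg) simp
  have kq: "real k * real q \<le> real n / real T"
  proof -
    have "real (k * r) \<le> real n" using krn by (simp only: of_nat_le_iff)
    then show ?thesis using T by (simp add: r_def field_simps)
  qed
  have nq: "real n / real T \<le> real k * real q + real k"
  proof -
    have "real n \<le> real (k * r + k * T)" using nkr by (simp only: of_nat_le_iff)
    then show ?thesis using T by (simp add: r_def field_simps)
  qed
  have 1: "\<bar>?P {1..n} - ?P {1..k*r}\<bar> \<le> real T * (real k * c)"
  proof -
    have "card {k*r+1..n} \<le> k * T" using nkr by simp
    then have "real (card {k*r+1..n}) * c \<le> real (k * T) * c"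
      using c0 by (intro mult_right_mono) (simp_all only: of_nat_le_iff)
    moreover have "?P {1..n} \<le> ?P {1..k*r}" "?P {1..k*r} \<le> ?P {1..n} + real (card {k*r+1..n}) * c"
      using drop_indices[where W = W and A = "{1..k*r}" and B = "{1..n}" and D = "{k*r+1..n}" and c = c and v = "u n"]
        meas c krn by force+
    ultimately show ?thesis by (simp add: mult_ac)
  qed
  have 2: "\<bar>?P {1..k*r} - ?P {1..r} ^ k\<bar> \<le> real k * (mixing_coeff M W u n l + 2 * real l * c)"
    using \<open>4 \<le> r\<close> \<open>l < r\<close>
    by (intro block_factorisation[where q = q and T = T] meas per T r_def krn k(1) c c0) auto
  define Q where "Q = ?P {1..r}"
  have Q: "0 \<le> Q" "Q \<le> 1" unfolding Q_def by auto
  have Q1: "1 - Q = \<P>(\<omega> in M. \<exists>j\<in>{1..r}. u n < W j \<omega>)"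
    unfolding Q_def by (subst prob_neg[symmetric]) (auto simp: not_le)
  have "1 - Q \<le> real r * c"
    using drop_indices(2)[where W = W and A = "{}" and B = "{1..r}" and D = "{1..r}" and c = c and v = "u n"]
      meas c unfolding Q_def by (simp add: prob_space)
  then have "real k * (1 - Q) \<le> real (k * r) * c" by (simp add: mult_left_mono mult.assoc)
  also have "\<dots> \<le> real n * c" using krn c0 by (intro mult_right_mono) (simp_all only: of_nat_le_iff)
  finally have kQ: "real k * (1 - Q) \<le> real n * c" .
  have 3: "\<bar>Q ^ k - exp (- (real k * (1 - Q)))\<bar> \<le> (real n * c)\<^sup>2 / real k"
  proof -
    \<comment> \<open>Written in this way the error is of order \<open>1 / k\<close>, because
      \<open>k * (1 - Q)\<close> is bounded by \<open>n * c\<close>.\<close>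
    have "real k * (1 - Q)\<^sup>2 = (real k * (1 - Q))\<^sup>2 / real k" using k by (simp add: power2_eq_square)
    also have "\<dots> \<le> (real n * c)\<^sup>2 / real k"
      using kQ Q by (intro divide_right_mono power_mono) auto
    finally show ?thesis using power_exp_approx[OF Q, of k] by linarith
  qed
  have "\<bar>(1 - Q) - real q * g\<bar> \<le> real q * h + real s * c"
    unfolding Q1 g_def h_def using cluster_count[where W = W and v = "u n", OF meas per s r_def c c0]
    by (simp add: r_def q_def)
  then have "real k * \<bar>(1 - Q) - real q * g\<bar> \<le> real k * (real q * h + real s * c)"
    by (intro mult_left_mono) auto
  moreover have "real k * real q * h \<le> real n / real T * h" using kq h0 by (rule mult_right_mono)
  ultimately have "\<bar>real k * (1 - Q) - real k * real q * g\<bar> \<le> real n / real T * h + real s * (real k * c)"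
    by (simp add: abs_mult[of "real k", symmetric, simplified] algebra_simps)
  moreover have "\<bar>real k * real q * g - real n / real T * g\<bar> \<le> real k * c"
  proof -
    have "real k * real q * g \<le> real n / real T * g" using kq g by (intro mult_right_mono)
    moreover have "real n / real T * g \<le> (real k * real q + real k) * g" using nq g by (intro mult_right_mono)
    moreover have "real k * g \<le> real k * c" using g by (intro mult_left_mono) auto
    ultimately show ?thesis by (simp add: distrib_right)
  qed
  moreover have "\<bar>exp (- (real k * (1 - Q))) - exp (- (real n / real T * g))\<bar> \<le> \<bar>real k * (1 - Q) - real n / real T * g\<bar>"
    using Q g by (intro exp_uminus_lipschitz) auto
  ultimately have 4: "\<bar>exp (- (real k * (1 - Q))) - exp (- (real n / real T * g))\<bar>
      \<le> real n / real T * h + real s * (real k * c) + real k * c" by linarith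
  show ?thesis using 1 2 3 4 unfolding Q_def[symmetric] by (simp add: algebra_simps)
qed

lemma void_probability_limit:
  fixes W :: "nat \<Rightarrow> 'a \<Rightarrow> real" and u :: "nat \<Rightarrow> real" and l k :: "nat \<Rightarrow> nat"
  assumes meas: "\<And>n. W n \<in> borel_measurable M"
    and per: "\<And>n. threshold_periodic W T (u n)" and T: "1 \<le> T" and s: "1 \<le> s"
    and k: "filterlim k at_top sequentially"
      "(\<lambda>n. real (k n) / real n) \<longlonglongrightarrow> 0"
      "(\<lambda>n. real (k n) * real (l n) / real n) \<longlonglongrightarrow> 0"
      "(\<lambda>n. real (k n) * mixing_coeff M W u n (l n)) \<longlonglongrightarrow> 0"
    and \<tau>: "(\<lambda>n. real n / real T * (\<Sum>i=1..T. \<P>(\<omega> in M. u n < W i \<omega>))) \<longlonglongrightarrow> \<tau>"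
    and D: "(\<lambda>n. real n / real T * (\<Sum>i=1..T. \<P>(\<omega> in M. u n < W i \<omega> \<and> (\<forall>j\<in>{i+1..i+s-1}. W j \<omega> \<le> u n)
                  \<and> (\<exists>j\<in>{i+s..n div (k n * T) * T}. u n < W j \<omega>)))) \<longlonglongrightarrow> 0"
  shows "(\<lambda>n. \<P>(\<omega> in M. \<forall>j\<in>{1..n}. W j \<omega> \<le> u n)
     - exp (- (real n / real T * (\<Sum>i=1..T. \<P>(\<omega> in M. u n < W i \<omega> \<and> (\<forall>j\<in>{i+1..i+s-1}. W j \<omega> \<le> u n))))))
     \<longlonglongrightarrow> 0"
proof (rule Lim_null_comparison)
  define c where "c n = (\<Sum>i=1..T. \<P>(\<omega> in M. u n < W i \<omega>))" for n
  let ?h = "\<lambda>n. \<Sum>i=1..T. \<P>(\<omega> in M. u n < W i \<omega> \<and> (\<forall>j\<in>{i+1..i+s-1}. W j \<omega> \<le> u n)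
                  \<and> (\<exists>j\<in>{i+s..n div (k n * T) * T}. u n < W j \<omega>))"
  define B where "B n = real (k n) * mixing_coeff M W u n (l n) + real n / real T * ?h n
      + (real T + real s + 1 + 2 * real (l n)) * (real (k n) * c n) + (real n * c n)\<^sup>2 / real (k n)" for n
  \<comment> \<open>Agrees with \<open>B\<close> for \<open>n > 0\<close>, regrouped so that each
    error is a convergent power of \<open>real n * c n\<close> times a vanishing ratio.\<close>
  define B' where "B' n = real (k n) * mixing_coeff M W u n (l n) + real n / real T * ?h n
      + (real T + real s + 1) * (real (k n) / real n) * (real n * c n)
      + 2 * (real (k n) * real (l n) / real n) * (real n * c n) + (real n * c n)\<^sup>2 * inverse (real (k n))" for n
  have C: "(\<lambda>n. real n * c n) \<longlonglongrightarrow> real T * \<tau>"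
    using tendsto_mult_left[OF \<tau>, of "real T"] T unfolding c_def by simp
  have ik: "(\<lambda>n. inverse (real (k n))) \<longlonglongrightarrow> 0"
    by (intro tendsto_inverse_0_at_top filterlim_compose[OF filterlim_real_sequentially k(1)])
  have "B' \<longlonglongrightarrow> 0 + 0 + (real T + real s + 1) * 0 * (real T * \<tau>) + 2 * 0 * (real T * \<tau>) + (real T * \<tau>)\<^sup>2 * 0"
    unfolding B'_def by (intro tendsto_intros C k D ik)
  moreover have "eventually (\<lambda>n. B' n = B n) sequentially"
    using eventually_gt_at_top[of 0]
    by eventually_elim (simp add: B_def B'_def field_simps)
  ultimately show "B \<longlonglongrightarrow> 0" using tendsto_cong by fastforce
  have e1: "eventually (\<lambda>n. 2 \<le> k n) sequentially" using k(1) by (simp add: filterlim_at_top)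
  \<comment> \<open>The thresholds \<open>1 / (4 * T)\<close> here and \<open>1 / 2\<close> below
    are the size conditions on \<open>k\<close> and \<open>l\<close> in
    \<open>void_probability_estimate\<close>, divided by \<open>n\<close>.\<close>
  have e2: "eventually (\<lambda>n. real (k n) / real n < 1 / (4 * real T)) sequentially"
    using T by (intro order_tendstoD(2)[OF k(2)]) simp
  have e3: "eventually (\<lambda>n. real (k n) * real (l n) / real n < 1 / 2) sequentially"
    by (intro order_tendstoD(2)[OF k(3)]) simp
  show "eventually (\<lambda>n. norm (\<P>(\<omega> in M. \<forall>j\<in>{1..n}. W j \<omega> \<le> u n)
     - exp (- (real n / real T * (\<Sum>i=1..T. \<P>(\<omega> in M. u n < W i \<omega> \<and> (\<forall>j\<in>{i+1..i+s-1}. W j \<omega> \<le> u n))))))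
     \<le> B n) sequentially"
    using e1 e2 e3 eventually_gt_at_top[of 0]
  proof eventually_elim
    case (elim n)
    have "real (4 * (k n * T)) \<le> real n" "real (2 * (k n * l n)) \<le> real n"
      using elim T by (auto simp: field_simps)
    then have "4 * (k n * T) \<le> n" "2 * (k n * l n) \<le> n" by (simp_all only: of_nat_le_iff)
    then show ?case using void_probability_estimate[OF meas per T s elim(1)] unfolding B_def c_def by simp
  qed
qed

end

subsection \<open>Stationary sequences\<close>

text \<open>The random index set has finitely many possible values, so the predicate is a finite
  disjunction over them.\<close>

lemma pred_random_index:
  assumes "finite J" and [measurable]: "\<And>j. Measurable.pred N (P j)" "\<And>S. Measurable.pred N (R S)"
  shows "Measurable.pred N (\<lambda>\<omega>. R {j\<in>J. P j \<omega>} \<omega>)"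
proof -
  have "R {j\<in>J. P j \<omega>} \<omega> \<longleftrightarrow> (\<exists>S\<in>Pow J. (\<forall>j\<in>J. j \<in> S \<longleftrightarrow> P j \<omega>) \<and> R S \<omega>)" for \<omega>
  proof
    assume "\<exists>S\<in>Pow J. (\<forall>j\<in>J. j \<in> S \<longleftrightarrow> P j \<omega>) \<and> R S \<omega>"
    then obtain S where "S \<subseteq> J" "\<forall>j\<in>J. j \<in> S \<longleftrightarrow> P j \<omega>" "R S \<omega>" by blast
    moreover from this have "{j\<in>J. P j \<omega>} = S" by blast
    ultimately show "R {j\<in>J. P j \<omega>} \<omega>" by simp
  next
    assume "R {j\<in>J. P j \<omega>} \<omega>"
    then show "\<exists>S\<in>Pow J. (\<forall>j\<in>J. j \<in> S \<longleftrightarrow> P j \<omega>) \<and> R S \<omega>"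
      by (intro bexI[of _ "{j\<in>J. P j \<omega>}"]) simp_all
  qed
  then have eq: "(\<lambda>\<omega>. R {j\<in>J. P j \<omega>} \<omega>) = (\<lambda>\<omega>. \<exists>S\<in>Pow J. (\<forall>j\<in>J. j \<in> S \<longleftrightarrow> P j \<omega>) \<and> R S \<omega>)"
    by (rule ext)
  have "Measurable.pred N (\<lambda>\<omega>. (\<forall>j\<in>J. j \<in> S \<longleftrightarrow> P j \<omega>) \<and> R S \<omega>)" for S
    using assms(1) by (intro pred_intros_logic pred_intros_finite assms) simp_all
  then show ?thesis unfolding eq using assms(1) by (intro pred_intros_finite) simp_all
qed

context prob_space
begin

lemma stationary_exceedances:
  assumes st: "strictly_stationary M X" and meas: "\<And>n. X n \<in> borel_measurable M" and "finite J"
  shows "\<P>(\<omega> in M. Q {j\<in>J. v < X (j + h) \<omega>}) = \<P>(\<omega> in M. Q {j\<in>J. v < X j \<omega>})"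
proof -
  note [measurable] = meas
  let ?N = "\<Pi>\<^sub>M j\<in>J. (borel :: real measure)"
  \<comment> \<open>The repeated \<open>j \<in> J\<close> makes the inner predicate measurable for
    every \<open>j\<close>: outside \<open>J\<close>, where \<open>f j\<close> is not a coordinate
    of the product, it is constantly false.\<close>
  let ?A = "{f \<in> space ?N. Q {j\<in>J. j \<in> J \<and> v < f j}}"
  have "Measurable.pred ?N (\<lambda>f. j \<in> J \<and> v < f j)" for j by (cases "j \<in> J") simp_all
  then have A: "?A \<in> sets ?N"
    using pred_random_index[where J = J and N = ?N and P = "\<lambda>j f. j \<in> J \<and> v < f j" and R = "\<lambda>S _. Q S"] \<open>finite J\<close>
    by (simp add: pred_def)
  have *: "\<P>(\<omega> in M. Q {j\<in>J. v < X (j + h) \<omega>}) = measure (distr M ?N (\<lambda>\<omega>. \<lambda>j\<in>J. X (j + h) \<omega>)) ?A" for h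
    using A by (subst measure_distr) (auto intro!: arg_cong[where f = prob] arg_cong[where f = Q] simp: space_PiM cong: conj_cong)
  show ?thesis using st \<open>finite J\<close> *[of h] *[of 0] unfolding strictly_stationary_def by simp
qed

lemma stationary_threshold_periodic:
  assumes "strictly_stationary M X" "\<And>n. X n \<in> borel_measurable M"
  shows "threshold_periodic X T v"
  unfolding threshold_periodic_def using stationary_exceedances[OF assms] by blast

lemma stationary_single:
  assumes "strictly_stationary M X" "\<And>n. X n \<in> borel_measurable M"
  shows "\<P>(\<omega> in M. v < X j \<omega>) = \<P>(\<omega> in M. v < X 0 \<omega>)"
  using stationary_exceedances[OF assms, where J = "{0}" and Q = "\<lambda>S. 0 \<in> S" and h = j] by simp

text \<open>With gap zero the two windows in the mixing coefficient may share an end point, while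
  each must have at least two indices. Let a(m) be the void probability of m consecutive indices.
  Mixing compares a(3) and a(4) with a(2)^2, and a(4) with a(2)a(3), so a(2)^2 and a(2)^3 differ by
  at most three mixing errors. Let x be the exceedance probability. Then a(2) \<ge> 1 - 2x \<ge> 1/2
  and 1 - a(2) \<ge> x, whence x/4 is at most three mixing errors; this is the constant 12.\<close>

lemma overlapping_windows_bound:
  fixes X :: "nat \<Rightarrow> 'a \<Rightarrow> real"
  assumes meas: "\<And>n. X n \<in> borel_measurable M" and per: "threshold_periodic X 1 (u n)"
    and n: "4 \<le> n" and small: "\<P>(\<omega> in M. u n < X 1 \<omega>) \<le> 1 / 4"
  shows "\<P>(\<omega> in M. u n < X 1 \<omega>) \<le> 12 * mixing_coeff M X u n 0"
proof -
  note [measurable] = meas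
  define a where "a m = \<P>(\<omega> in M. \<forall>j\<in>{1..m}. X j \<omega> \<le> u n)" for m
  let ?al = "mixing_coeff M X u n 0"
  have w: "\<P>(\<omega> in M. \<forall>j\<in>{d+1..d+m}. X j \<omega> \<le> u n) = a m" for d m
    using threshold_periodic_block[OF per, of d m] unfolding a_def by simp
  have wu: "\<P>(\<omega> in M. (\<forall>j\<in>{1..2}. X j \<omega> \<le> u n) \<and> (\<forall>j\<in>{d+1..d+m}. X j \<omega> \<le> u n)) = a (d + m)"
    if "1 \<le> d" "d \<le> 2" "2 \<le> m" for d m
  proof -
    have "{1..2} \<union> {d+1..d+m} = {1..d+m}" using that by auto
    then show ?thesis unfolding a_def ball_Un[symmetric] by simp
  qed
  have mix: "\<bar>a (d + m) - a 2 * a m\<bar> \<le> ?al" if "1 \<le> d" "d \<le> 2" "2 \<le> m" "d + m \<le> n" for d m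
  proof -
    have "d + 1 + (m - 1) = d + m" "(1::nat) + 1 = 2" using that by simp_all
    then show ?thesis
      using mixing_coeff_bound[of 1 1 0 "d+1" "m-1" n X u] that w[of d m] w[of 0 2] wu[of d m]
      by (simp add: numeral_2_eq_2)
  qed
  have m: "\<bar>a 3 - a 2 * a 2\<bar> \<le> ?al" "\<bar>a 4 - a 2 * a 2\<bar> \<le> ?al" "\<bar>a 4 - a 2 * a 3\<bar> \<le> ?al"
  proof -
    have "(1::nat) + 2 = 3" "(2::nat) + 2 = 4" "(1::nat) + 3 = 4" by simp_all
    from mix[of 1 2, unfolded this] mix[of 2 2, unfolded this] mix[of 1 3, unfolded this]
    show "\<bar>a 3 - a 2 * a 2\<bar> \<le> ?al" "\<bar>a 4 - a 2 * a 2\<bar> \<le> ?al" "\<bar>a 4 - a 2 * a 3\<bar> \<le> ?al"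
      using n by simp_all
  qed
  let ?x = "\<P>(\<omega> in M. u n < X 1 \<omega>)"
  have a1: "a 1 = 1 - ?x" unfolding a_def
    by (subst prob_neg[symmetric]) (auto simp: not_less)
  have x2: "\<P>(\<omega> in M. u n < X 2 \<omega>) = ?x"
    using threshold_periodic_single[OF per, of 1 1] by (simp add: numeral_2_eq_2)
  have a2: "a 2 \<le> a 1" "a 1 \<le> a 2 + ?x"
    using drop_indices[where W = X and A = "{1..1}" and B = "{1..2}" and D = "{2}" and c = ?x and v = "u n"]
      meas x2 unfolding a_def by (simp_all add: numeral_2_eq_2 atLeastAtMostSuc_conv)
  have b: "1 / 2 \<le> a 2" "a 2 \<le> 1 - ?x" using a1 a2 small by auto
  have "a 2 * a 3 \<le> a 2 * (a 2 * a 2) + ?al"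
  proof -
    have "a 2 * (a 3 - a 2 * a 2) \<le> a 2 * ?al"
      using m(1) b by (intro mult_left_mono) linarith+
    also have "a 2 * ?al \<le> 1 * ?al"
      using m(1) unfolding a_def by (intro mult_right_mono prob_le_1) linarith
    finally show ?thesis by (simp add: algebra_simps)
  qed
  then have "(a 2 * a 2) * (1 - a 2) \<le> 3 * ?al" using m by (simp add: algebra_simps abs_le_iff)
  moreover have "(1 / 2 * (1 / 2)) * ?x \<le> (a 2 * a 2) * (1 - a 2)"
    using b by (intro mult_mono) auto
  ultimately show ?thesis by simp
qed

text \<open>A gap \<open>l n = 0\<close> is admissible, and then the blocks in the mixing coefficient may overlap; only this
  overlap bounds \<open>k n\<close>, since \<open>k n * l n / n\<close> vanishes.\<close>

lemma number_of_blocks_small_o: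
  fixes X :: "nat \<Rightarrow> 'a \<Rightarrow> real" and k l :: "nat \<Rightarrow> nat"
  assumes meas: "\<And>n. X n \<in> borel_measurable M" and per: "\<And>n. threshold_periodic X 1 (u n)"
    and \<tau>: "(\<lambda>n. real n * \<P>(\<omega> in M. u n < X 1 \<omega>)) \<longlonglongrightarrow> \<tau>" "0 < \<tau>"
    and k: "(\<lambda>n. real (k n) * real (l n) / real n) \<longlonglongrightarrow> 0"
      "(\<lambda>n. real (k n) * mixing_coeff M X u n (l n)) \<longlonglongrightarrow> 0"
  shows "(\<lambda>n. real (k n) / real n) \<longlonglongrightarrow> 0"
proof (rule Lim_null_comparison)
  let ?x = "\<lambda>n. \<P>(\<omega> in M. u n < X 1 \<omega>)"
  let ?al = "\<lambda>n. mixing_coeff M X u n (l n)"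
  \<comment> \<open>The first summand covers \<open>l n \<ge> 1\<close>. The second covers
    \<open>l n = 0\<close>, where eventually \<open>n * ?x n > \<tau> / 2\<close> and
    \<open>?x n \<le> 12 * ?al n\<close>, so that 24 is 2 times 12.\<close>
  let ?B = "\<lambda>n. real (k n) * real (l n) / real n + 24 / \<tau> * \<bar>real (k n) * ?al n\<bar>"
  have "?B \<longlonglongrightarrow> 0 + 24 / \<tau> * \<bar>0\<bar>" by (intro tendsto_intros k)
  then show "?B \<longlonglongrightarrow> 0" by simp
  have "(\<lambda>n. real n * ?x n * inverse (real n)) \<longlonglongrightarrow> \<tau> * 0"
    by (intro tendsto_intros \<tau> tendsto_inverse_0_at_top filterlim_real_sequentially)
  then have "eventually (\<lambda>n. real n * ?x n * inverse (real n) < 1 / 4) sequentially"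
    by (intro order_tendstoD(2)) auto
  moreover have "eventually (\<lambda>n. \<tau> / 2 < real n * ?x n) sequentially"
    using \<tau> by (intro order_tendstoD(1)[OF \<tau>(1)]) auto
  ultimately show "eventually (\<lambda>n. norm (real (k n) / real n) \<le> ?B n) sequentially"
    using eventually_ge_at_top[of 4]
  proof eventually_elim
    case (elim n)
    show ?case
    proof (cases "l n = 0")
      case False
      then have "real (k n) * 1 \<le> real (k n) * real (l n)" by (intro mult_left_mono) auto
      then have "real (k n) / real n \<le> real (k n) * real (l n) / real n" by (intro divide_right_mono) auto
      moreover have "0 \<le> 24 / \<tau> * \<bar>real (k n) * ?al n\<bar>" using \<tau>(2) by simp
      ultimately show ?thesis by simp
    next
      case True
      have "?x n \<le> 1 / 4" using elim by (simp add: field_simps)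
      then have "?x n \<le> 12 * ?al n"
        using overlapping_windows_bound[where u = u, OF meas per elim(3)] True by simp
      then have "real (k n) * ?x n \<le> real (k n) * (12 * ?al n)" by (intro mult_left_mono) auto
      moreover have "real (k n) / real n * (\<tau> / 2) \<le> real (k n) / real n * (real n * ?x n)"
        using elim by (intro mult_left_mono) auto
      ultimately have "real (k n) / real n * (\<tau> / 2) \<le> 12 * \<bar>real (k n) * ?al n\<bar>"
        using elim(3) by simp
      then show ?thesis using \<tau>(2) True by (simp add: field_simps)
    qed
  qed
qed

end

subsection \<open>Periodicity of the switched sequence\<close>

lemma Y_seq_shift:
  assumes "1 \<le> n" "1 \<le> T"
  shows "Y_seq T U X (n + c * T) \<omega> = Y_seq T (\<lambda>i. U (i + c * T)) (\<lambda>i. X (i + c * T)) n \<omega>"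
proof -
  have "(n + c * T - 1) div T * T = (n - 1) div T * T + c * T"
  proof -
    have "n + c * T - 1 = (n - 1) + c * T" using assms by simp
    then show ?thesis using assms by (simp only: div_mult_self1 add_mult_distrib)
  qed
  moreover have "n + c * T - 1 = (n - 1) + c * T" using assms by simp
  ultimately have "{(n + c * T - 1) div T * T..n + c * T - 1} = (\<lambda>i. i + c * T) ` {(n - 1) div T * T..n - 1}"
    by simp
  then show ?thesis unfolding Y_seq_def by (simp only: image_image)
qed

lemma Y_seq_cong:
  assumes "\<And>i. i \<le> n \<Longrightarrow> U i \<omega> = U' i \<omega>'" "\<And>i. i \<le> n \<Longrightarrow> X i \<omega> = X' i \<omega>'"
  shows "Y_seq T U X n \<omega> = Y_seq T U' X' n \<omega>'"
proof -
  have "(\<lambda>i. U i \<omega> * X i \<omega>) ` {(n - 1) div T * T..n - 1} = (\<lambda>i. U' i \<omega>' * X' i \<omega>') ` {(n - 1) div T * T..n - 1}"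
    by (rule image_cong) (auto simp: assms)
  then show ?thesis unfolding Y_seq_def by (simp add: assms)
qed

lemma Y_seq_measurable:
  assumes "\<And>i. i \<le> n \<Longrightarrow> U i \<in> borel_measurable N" "\<And>i. i \<le> n \<Longrightarrow> X i \<in> borel_measurable N"
  shows "Y_seq T U X n \<in> borel_measurable N"
proof -
  have "(\<lambda>\<omega>. MAX i\<in>{(n - 1) div T * T..n - 1}. U i \<omega> * X i \<omega>) \<in> borel_measurable N"
    by (intro borel_measurable_Max borel_measurable_times assms) auto
  then have "(\<lambda>\<omega>. U n \<omega> * X n \<omega> + (1 - U n \<omega>) * (MAX i\<in>{(n - 1) div T * T..n - 1}. U i \<omega> * X i \<omega>)) \<in> borel_measurable N"
    by (intro borel_measurable_times borel_measurable_add borel_measurable_diff borel_measurable_const assms) auto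
  then show ?thesis unfolding Y_seq_def[abs_def] .
qed

context prob_space
begin

text \<open>By independence both joint laws are products of their marginals, and the marginals
  agree.\<close>

lemma periodic_independent_block:
  fixes U :: "nat \<Rightarrow> 'a \<Rightarrow> real"
  assumes U: "indep_vars (\<lambda>_. borel) U UNIV"
    and per: "\<And>i. distr M borel (U (i + h)) = distr M borel (U i)"
    and N: "finite N"
  shows "distr M (\<Pi>\<^sub>M i\<in>N. borel) (\<lambda>\<omega>. \<lambda>i\<in>N. U (i + h) \<omega>) = distr M (\<Pi>\<^sub>M i\<in>N. borel) (\<lambda>\<omega>. \<lambda>i\<in>N. U i \<omega>)"
proof (cases "N = {}")
  case False
  have meas: "random_variable borel (U i)" for i using U unfolding indep_vars_def by blast
  have "indep_vars (\<lambda>_. borel) U N" using indep_vars_subset[OF U] by blast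
  then have 1: "distr M (\<Pi>\<^sub>M i\<in>N. borel) (\<lambda>\<omega>. \<lambda>i\<in>N. U i \<omega>) = (\<Pi>\<^sub>M i\<in>N. distr M borel (U i))"
    using indep_vars_iff_distr_eq_PiM'[OF False, of U "\<lambda>_. borel"] meas by simp
  have "indep_vars (\<lambda>_. borel) (\<lambda>i. U (i + h)) N"
  proof (subst indep_vars_finite[where E = "\<lambda>_. sets borel"])
    show "\<forall>A\<in>N \<rightarrow> sets borel. prob (\<Inter>j\<in>N. U (j + h) -` A j \<inter> space M) = (\<Prod>j\<in>N. prob (U (j + h) -` A j \<inter> space M))"
    proof
      fix A assume A: "A \<in> N \<rightarrow> sets (borel :: real measure)"
      \<comment> \<open>The shifted family is the original one on the translate of \<open>N\<close>,
        so the test sets are translated back by \<open>A (i - h)\<close>.\<close>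
      have "prob (\<Inter>i\<in>(\<lambda>i. i + h) ` N. U i -` A (i - h) \<inter> space M) = (\<Prod>i\<in>(\<lambda>i. i + h) ` N. prob (U i -` A (i - h) \<inter> space M))"
        using A N False by (intro indep_varsD[OF U]) auto
      moreover have "(\<Inter>i\<in>(\<lambda>i. i + h) ` N. U i -` A (i - h) \<inter> space M) = (\<Inter>j\<in>N. U (j + h) -` A j \<inter> space M)"
        by (simp only: image_image add_diff_cancel_right')
      ultimately show "prob (\<Inter>j\<in>N. U (j + h) -` A j \<inter> space M) = (\<Prod>j\<in>N. prob (U (j + h) -` A j \<inter> space M))"
        by (simp only: prod.reindex inj_on_add' comp_def add_diff_cancel_right')
    qed
  qed (use N False meas in \<open>auto simp: sets.Int_stable sets.sigma_sets_eq[of borel, simplified]\<close>)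
  then have 2: "distr M (\<Pi>\<^sub>M i\<in>N. borel) (\<lambda>\<omega>. \<lambda>i\<in>N. U (i + h) \<omega>) = (\<Pi>\<^sub>M i\<in>N. distr M borel (U (i + h)))"
    using indep_vars_iff_distr_eq_PiM'[OF False, of "\<lambda>i. U (i + h)" "\<lambda>_. borel"] meas by (simp add: comp_def)
  show ?thesis unfolding 1 2 per ..
qed (simp add: restrict_def)

text \<open>Up to a finite time Y is a fixed function of finitely many X and U, and it commutes with
  shifts by multiples of \<open>T\<close>. The joint law of these X and U is a product by
  independence, and each factor is invariant under such shifts: the first by stationarity, the
  second by periodicity of the marginals.\<close>

lemma Y_seq_threshold_periodic:
  fixes U X :: "nat \<Rightarrow> 'a \<Rightarrow> real"
  assumes X: "\<And>n. X n \<in> borel_measurable M" "strictly_stationary M X"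
    and U: "indep_vars (\<lambda>_. borel) U UNIV"
    and per: "\<And>i c. distr M borel (U (i + c * T)) = distr M borel (U i)"
    and XU: "indep_var (\<Pi>\<^sub>M i\<in>UNIV. borel) (\<lambda>\<omega> n. X n \<omega>) (\<Pi>\<^sub>M i\<in>UNIV. borel) (\<lambda>\<omega> n. U n \<omega>)"
    and T: "1 \<le> T"
  shows "threshold_periodic (Y_seq T U X) T v"
  unfolding threshold_periodic_def
proof (intro allI impI)
  fix J :: "nat set" and c :: nat and Q :: "nat set \<Rightarrow> bool"
  assume J: "finite J" "0 \<notin> J"
  obtain m where m: "\<And>j. j \<in> J \<Longrightarrow> j \<le> m" using J(1) by (meson finite_nat_set_iff_bounded_le)
  let ?N = "\<Pi>\<^sub>M i\<in>{..m}. (borel :: real measure)"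
  define Z where "Z h \<omega> = (\<lambda>i\<in>{..m}. X (i + h) \<omega>, \<lambda>i\<in>{..m}. U (i + h) \<omega>)" for h \<omega>
  \<comment> \<open>\<open>Y_seq\<close> read on the product space, with the coordinates of the pair
    \<open>z\<close> in place of the random variables.\<close>
  let ?y = "Y_seq T (\<lambda>i z. snd z i) (\<lambda>i z. fst z i)"
  let ?A = "{z \<in> space (?N \<Otimes>\<^sub>M ?N). Q {j\<in>J. j \<in> J \<and> v < ?y j z}}"
  have [measurable]: "random_variable borel (U i)" for i using U unfolding indep_vars_def by blast
  note [measurable] = X(1)
  have ind: "indep_var ?N (\<lambda>\<omega>. \<lambda>i\<in>{..m}. X (i + h) \<omega>) ?N (\<lambda>\<omega>. \<lambda>i\<in>{..m}. U (i + h) \<omega>)" for h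
  proof -
    have f: "(\<lambda>x. \<lambda>i\<in>{..m}. x (i + h)) \<in> measurable (\<Pi>\<^sub>M i\<in>UNIV. borel) ?N"
      by measurable
    show ?thesis using indep_var_compose[OF XU f f] by (simp add: comp_def)
  qed
  have dZ: "distr M (?N \<Otimes>\<^sub>M ?N) (Z h) = distr M ?N (\<lambda>\<omega>. \<lambda>i\<in>{..m}. X (i + h) \<omega>) \<Otimes>\<^sub>M distr M ?N (\<lambda>\<omega>. \<lambda>i\<in>{..m}. U (i + h) \<omega>)" for h
    using ind[of h] unfolding indep_var_distribution_eq Z_def[abs_def] by simp
  have eqZ: "distr M (?N \<Otimes>\<^sub>M ?N) (Z (c * T)) = distr M (?N \<Otimes>\<^sub>M ?N) (Z 0)"
    unfolding dZ using X(2) periodic_independent_block[OF U per, of "{..m}" c]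
    unfolding strictly_stationary_def by simp
  have "Measurable.pred (?N \<Otimes>\<^sub>M ?N) (\<lambda>z. j \<in> J \<and> v < ?y j z)" for j
  proof (cases "j \<in> J")
    case True
    have [measurable]: "?y j \<in> borel_measurable (?N \<Otimes>\<^sub>M ?N)"
      using m[OF True] by (intro Y_seq_measurable) (auto intro!: measurable_compose[OF measurable_fst] measurable_compose[OF measurable_snd] measurable_component_singleton)
    show ?thesis by measurable
  qed simp
  then have A: "?A \<in> sets (?N \<Otimes>\<^sub>M ?N)"
    using pred_random_index[where J = J and N = "?N \<Otimes>\<^sub>M ?N" and P = "\<lambda>j z. j \<in> J \<and> v < ?y j z" and R = "\<lambda>S _. Q S"] J(1)
    by (simp add: pred_def)
  have Zm: "Z h \<in> measurable M (?N \<Otimes>\<^sub>M ?N)" for h unfolding Z_def by measurable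
  have *: "\<P>(\<omega> in M. Q {j\<in>J. v < Y_seq T U X (j + d * T) \<omega>}) = measure (distr M (?N \<Otimes>\<^sub>M ?N) (Z (d * T))) ?A" for d
  proof -
    have "{j\<in>J. v < Y_seq T U X (j + d * T) \<omega>} = {j\<in>J. j \<in> J \<and> v < ?y j (Z (d * T) \<omega>)}" for \<omega>
    proof -
      have "Y_seq T U X (j + d * T) \<omega> = ?y j (Z (d * T) \<omega>)" if "j \<in> J" for j
      proof -
        have "1 \<le> j" using J(2) that by (cases j) auto
        then show ?thesis unfolding Y_seq_shift[OF \<open>1 \<le> j\<close> T]
          using m[OF that] by (intro Y_seq_cong) (simp_all add: Z_def)
      qed
      then show ?thesis by auto
    qed
    then have "{\<omega> \<in> space M. Q {j\<in>J. v < Y_seq T U X (j + d * T) \<omega>}} = Z (d * T) -` ?A \<inter> space M"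
      using measurable_space[OF Zm, of _ "d * T"] by auto
    then show ?thesis using A Zm by (simp add: measure_distr)
  qed
  show "\<P>(\<omega> in M. Q {j\<in>J. v < Y_seq T U X (j + c * T) \<omega>}) = \<P>(\<omega> in M. Q {j\<in>J. v < Y_seq T U X j \<omega>})"
    using *[of c] *[of 0] eqZ by simp
qed

end

subsection \<open>Random switching patterns\<close>

context prob_space
begin

lemma bernoulli_pattern_prob:
  fixes U :: "nat \<Rightarrow> 'a \<Rightarrow> real" and X :: "nat \<Rightarrow> 'a \<Rightarrow> real"
  assumes U: "indep_vars (\<lambda>_. borel) U UNIV"
    and XU: "indep_var (\<Pi>\<^sub>M i\<in>UNIV. borel) (\<lambda>\<omega> n. X n \<omega>) (\<Pi>\<^sub>M i\<in>UNIV. borel) (\<lambda>\<omega> n. U n \<omega>)"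
    and ber: "\<And>j. j \<in> A \<union> B \<Longrightarrow> \<P>(\<omega> in M. U j \<omega> = 1) = p" "\<And>j. j \<in> A \<union> B \<Longrightarrow> \<P>(\<omega> in M. U j \<omega> = 0) = 1 - p"
    and AB: "finite A" "finite B" "A \<inter> B = {}"
    and R: "Measurable.pred (\<Pi>\<^sub>M i\<in>UNIV. borel) R"
  shows "\<P>(\<omega> in M. R (\<lambda>n. X n \<omega>) \<and> (\<forall>j\<in>A. U j \<omega> = 1) \<and> (\<forall>j\<in>B. U j \<omega> = 0))
    = \<P>(\<omega> in M. R (\<lambda>n. X n \<omega>)) * (p ^ card A * (1 - p) ^ card B)"
proof -
  have [measurable]: "random_variable borel (U i)" for i using U unfolding indep_vars_def by blast
  let ?N = "\<Pi>\<^sub>M i\<in>(UNIV :: nat set). (borel :: real measure)"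
  let ?R = "{x \<in> space ?N. R x}"
  let ?S = "{w \<in> space ?N. (\<forall>j\<in>A. w j = 1) \<and> (\<forall>j\<in>B. w j = 0)}"
  have "?R \<in> sets ?N" using R by (simp add: pred_def)
  moreover have "?S \<in> sets ?N" using AB by measurable
  ultimately have "prob ((\<lambda>x. (\<lambda>n. X n x, \<lambda>n. U n x)) -` (?R \<times> ?S) \<inter> space M) =
      prob ((\<lambda>\<omega> n. X n \<omega>) -` ?R \<inter> space M) * prob ((\<lambda>\<omega> n. U n \<omega>) -` ?S \<inter> space M)"
    by (rule indep_varD[OF XU])
  moreover have "(\<lambda>x. (\<lambda>n. X n x, \<lambda>n. U n x)) -` (?R \<times> ?S) \<inter> space M
      = {\<omega> \<in> space M. R (\<lambda>n. X n \<omega>) \<and> (\<forall>j\<in>A. U j \<omega> = 1) \<and> (\<forall>j\<in>B. U j \<omega> = 0)}"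
    by (auto simp: space_PiM)
  moreover have "(\<lambda>\<omega> n. X n \<omega>) -` ?R \<inter> space M = {\<omega> \<in> space M. R (\<lambda>n. X n \<omega>)}"
    by (auto simp: space_PiM)
  moreover have "prob ((\<lambda>\<omega> n. U n \<omega>) -` ?S \<inter> space M) = p ^ card A * (1 - p) ^ card B"
  proof (cases "A \<union> B = {}")
    case False
    let ?V = "\<lambda>j. if j \<in> A then {1} else {0::real}"
    have "(\<forall>j\<in>A. U j \<omega> \<in> ?V j) \<longleftrightarrow> (\<forall>j\<in>A. U j \<omega> = 1)" "(\<forall>j\<in>B. U j \<omega> \<in> ?V j) \<longleftrightarrow> (\<forall>j\<in>B. U j \<omega> = 0)" for \<omega>
      by (rule ball_cong; use AB(3) in auto)+
    then have "(\<lambda>\<omega> n. U n \<omega>) -` ?S \<inter> space M = {\<omega> \<in> space M. \<forall>j\<in>A \<union> B. U j \<omega> \<in> ?V j}"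
      unfolding ball_Un by (simp add: space_PiM vimage_def Int_def conj_commute)
    also have "\<dots> = (\<Inter>j\<in>A \<union> B. U j -` ?V j \<inter> space M)"
      using False by blast
    also have "prob \<dots> = (\<Prod>j\<in>A \<union> B. prob (U j -` ?V j \<inter> space M))"
      using AB False by (intro indep_varsD[OF U]) auto
    also have "\<dots> = (\<Prod>j\<in>A. prob (U j -` ?V j \<inter> space M)) * (\<Prod>j\<in>B. prob (U j -` ?V j \<inter> space M))"
      using AB by (rule prod.union_disjoint)
    also have "(\<Prod>j\<in>A. prob (U j -` ?V j \<inter> space M)) = (\<Prod>j\<in>A. p)"
    proof (rule prod.cong)
      fix j assume j: "j \<in> A"
      have "U j -` {1} \<inter> space M = {\<omega> \<in> space M. U j \<omega> = 1}" by auto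
      then show "prob (U j -` ?V j \<inter> space M) = p" using ber(1)[of j] j by simp
    qed simp
    also have "(\<Prod>j\<in>B. prob (U j -` ?V j \<inter> space M)) = (\<Prod>j\<in>B. 1 - p)"
    proof (rule prod.cong)
      fix j assume j: "j \<in> B"
      then have "j \<notin> A" using AB(3) by blast
      have "U j -` {0} \<inter> space M = {\<omega> \<in> space M. U j \<omega> = 0}" by auto
      then show "prob (U j -` ?V j \<inter> space M) = 1 - p" using ber(2)[of j] j \<open>j \<notin> A\<close> by simp
    qed simp
    finally show ?thesis by simp
  next
    case True
    then have "(\<lambda>\<omega> n. U n \<omega>) -` ?S \<inter> space M = space M" by (auto simp: space_PiM)
    then show ?thesis using True by (simp add: prob_space space_PiM)
  qed
  ultimately show ?thesis by simp
qed

text \<open>Conditioning on the switches: almost surely exactly one pair of on-sets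
  \<open>J\<close>, \<open>I\<close> occurs, and for each pair the X part factors out.
  \<open>K\<close> and \<open>L\<close> carry the free switches, which will be those before the
  cluster end and those of the next period; \<open>A\<close> is forced on and \<open>B\<close>
  forced off.\<close>

lemma bernoulli_pattern_sum:
  fixes U :: "nat \<Rightarrow> 'a \<Rightarrow> real" and X :: "nat \<Rightarrow> 'a \<Rightarrow> real"
  assumes U: "indep_vars (\<lambda>_. borel) U UNIV"
    and XU: "indep_var (\<Pi>\<^sub>M i\<in>UNIV. borel) (\<lambda>\<omega> n. X n \<omega>) (\<Pi>\<^sub>M i\<in>UNIV. borel) (\<lambda>\<omega> n. U n \<omega>)"
    and ber: "\<And>j. j \<in> K \<union> L \<union> A \<union> B \<Longrightarrow> \<P>(\<omega> in M. U j \<omega> = 1) = p"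
      "\<And>j. j \<in> K \<union> L \<union> A \<union> B \<Longrightarrow> \<P>(\<omega> in M. U j \<omega> = 0) = 1 - p"
    and bin: "AE \<omega> in M. \<forall>j. U j \<omega> = 0 \<or> U j \<omega> = 1"
    and fin: "finite K" "finite L" "finite A" "finite B"
    and disj: "K \<inter> L = {}" "K \<inter> A = {}" "K \<inter> B = {}" "L \<inter> A = {}" "L \<inter> B = {}" "A \<inter> B = {}"
    and R: "\<And>J I. Measurable.pred (\<Pi>\<^sub>M i\<in>UNIV. borel) (R J I)"
  shows "\<P>(\<omega> in M. R {j\<in>K. U j \<omega> = 1} {j\<in>L. U j \<omega> = 1} (\<lambda>n. X n \<omega>) \<and> (\<forall>j\<in>A. U j \<omega> = 1) \<and> (\<forall>j\<in>B. U j \<omega> = 0))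
    = (\<Sum>J\<in>Pow K. \<Sum>I\<in>Pow L. \<P>(\<omega> in M. R J I (\<lambda>n. X n \<omega>)) *
         (p ^ (card J + card I + card A) * (1 - p) ^ (card K - card J + (card L - card I) + card B)))"
proof -
  have [measurable]: "random_variable borel (U i)" for i using U unfolding indep_vars_def by blast
  have [measurable]: "(\<lambda>\<omega> n. X n \<omega>) \<in> measurable M (\<Pi>\<^sub>M i\<in>UNIV. borel)"
    using indep_var_rv1[OF XU] .
  note [measurable] = R
  let ?E = "\<lambda>\<omega>. R {j\<in>K. U j \<omega> = 1} {j\<in>L. U j \<omega> = 1} (\<lambda>n. X n \<omega>) \<and> (\<forall>j\<in>A. U j \<omega> = 1) \<and> (\<forall>j\<in>B. U j \<omega> = 0)"
  let ?F = "\<lambda>s \<omega>. R (fst s) (snd s) (\<lambda>n. X n \<omega>) \<and> (\<forall>j\<in>fst s \<union> snd s \<union> A. U j \<omega> = 1)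
      \<and> (\<forall>j\<in>(K - fst s) \<union> (L - snd s) \<union> B. U j \<omega> = 0)"
  have RX: "Measurable.pred M (\<lambda>\<omega>. R J I (\<lambda>n. X n \<omega>))" for J I by measurable
  have K: "Measurable.pred M (\<lambda>\<omega>. R J {j\<in>L. U j \<omega> = 1} (\<lambda>n. X n \<omega>))" for J
    by (rule pred_random_index[where R = "\<lambda>I \<omega>. R J I (\<lambda>n. X n \<omega>)", OF fin(2) _ RX]) measurable
  have "Measurable.pred M (\<lambda>\<omega>. R {j\<in>K. U j \<omega> = 1} {j\<in>L. U j \<omega> = 1} (\<lambda>n. X n \<omega>))"
    by (rule pred_random_index[where R = "\<lambda>J \<omega>. R J {j\<in>L. U j \<omega> = 1} (\<lambda>n. X n \<omega>)", OF fin(1) _ K]) measurable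
  then have E: "{\<omega> \<in> space M. ?E \<omega>} \<in> events" using fin by measurable
  have unique: "J = {j\<in>K. U j \<omega> = 1}" if "J \<subseteq> K" "\<forall>j\<in>J. U j \<omega> = 1" "\<forall>j\<in>K - J. U j \<omega> = 0" for J K \<omega>
  proof (intro equalityI subsetI)
    fix j assume "j \<in> {j\<in>K. U j \<omega> = 1}"
    then show "j \<in> J" using that(3) by (cases "j \<in> J") auto
  qed (use that in auto)
  have ae: "AE \<omega> in M. (\<forall>s\<in>Pow K \<times> Pow L. ?F s \<omega> \<longrightarrow> ?E \<omega>) \<and> (?E \<omega> \<longrightarrow> (\<exists>!s\<in>Pow K \<times> Pow L. ?F s \<omega>))"
    using bin
  proof (rule AE_mp, intro AE_I2 impI)
    fix \<omega> assume bin: "\<forall>j. U j \<omega> = 0 \<or> U j \<omega> = 1"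
    let ?s = "({j\<in>K. U j \<omega> = 1}, {j\<in>L. U j \<omega> = 1})"
    have s: "s = ?s" if "s \<in> Pow K \<times> Pow L" "?F s \<omega>" for s
    proof -
      have "fst s = {j\<in>K. U j \<omega> = 1}" using that by (intro unique) auto
      moreover have "snd s = {j\<in>L. U j \<omega> = 1}" using that by (intro unique) auto
      ultimately show ?thesis by (metis prod.collapse)
    qed
    have 1: "?E \<omega>" if "s \<in> Pow K \<times> Pow L" "?F s \<omega>" for s
    proof -
      have eq: "fst s = {j\<in>K. U j \<omega> = 1}" "snd s = {j\<in>L. U j \<omega> = 1}"
        unfolding s[OF that] by simp_all
      show ?thesis using that(2) unfolding eq by blast
    qed
    have 2: "?F ?s \<omega>" if "?E \<omega>"
    proof (intro conjI)
      show "R (fst ?s) (snd ?s) (\<lambda>n. X n \<omega>)" using that by simp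
      show "\<forall>j\<in>fst ?s \<union> snd ?s \<union> A. U j \<omega> = 1" using that by auto
      show "\<forall>j\<in>(K - fst ?s) \<union> (L - snd ?s) \<union> B. U j \<omega> = 0"
      proof
        fix j assume j: "j \<in> (K - fst ?s) \<union> (L - snd ?s) \<union> B"
        show "U j \<omega> = 0"
        proof (cases "j \<in> B")
          case True then show ?thesis using that by blast
        next
          case False
          then have "U j \<omega> \<noteq> 1" using j by auto
          then show ?thesis using bin by blast
        qed
      qed
    qed
    have 3: "?s \<in> Pow K \<times> Pow L" by auto
    have "\<exists>!s. s \<in> Pow K \<times> Pow L \<and> ?F s \<omega>" if "?E \<omega>"
    proof (rule ex1I)
      show "?s \<in> Pow K \<times> Pow L \<and> ?F ?s \<omega>" using 3 2[OF that] by (rule conjI)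
    next
      fix s assume s': "s \<in> Pow K \<times> Pow L \<and> ?F s \<omega>"
      show "s = ?s" by (rule s[OF s'[THEN conjunct1] s'[THEN conjunct2]])
    qed
    then have 4: "?E \<omega> \<longrightarrow> (\<exists>!s\<in>Pow K \<times> Pow L. ?F s \<omega>)" by (rule impI)
    have 5: "\<forall>s\<in>Pow K \<times> Pow L. ?F s \<omega> \<longrightarrow> ?E \<omega>"
    proof (rule ballI, rule impI)
      fix s assume "s \<in> Pow K \<times> Pow L" "?F s \<omega>"
      then show "?E \<omega>" by (rule 1)
    qed
    show "(\<forall>s\<in>Pow K \<times> Pow L. ?F s \<omega> \<longrightarrow> ?E \<omega>) \<and> (?E \<omega> \<longrightarrow> (\<exists>!s\<in>Pow K \<times> Pow L. ?F s \<omega>))"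
      by (rule conjI[OF 5 4])
  qed
  have ev: "{\<omega> \<in> space M. ?F s \<omega>} \<in> events" if "s \<in> Pow K \<times> Pow L" for s
    using RX by measurable
  have "\<P>(\<omega> in M. ?E \<omega>) = (\<Sum>s\<in>Pow K \<times> Pow L. \<P>(\<omega> in M. ?F s \<omega>))"
    by (rule prob_sum[OF _ ev E ae]) (use fin in simp)
  also have "\<dots> = (\<Sum>s\<in>Pow K \<times> Pow L. \<P>(\<omega> in M. R (fst s) (snd s) (\<lambda>n. X n \<omega>)) *
         (p ^ (card (fst s) + card (snd s) + card A) * (1 - p) ^ (card K - card (fst s) + (card L - card (snd s)) + card B)))"
  proof (rule sum.cong)
    fix s assume "s \<in> Pow K \<times> Pow L"
    then have s: "fst s \<subseteq> K" "snd s \<subseteq> L" by auto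
    then have f: "finite (fst s)" "finite (snd s)" using fin finite_subset by auto
    have c1: "card (fst s \<union> snd s \<union> A) = card (fst s) + card (snd s) + card A"
      using s f fin disj by (subst card_Un_disjoint; (subst card_Un_disjoint)?) auto
    have c2: "card ((K - fst s) \<union> (L - snd s) \<union> B) = card K - card (fst s) + (card L - card (snd s)) + card B"
      using s f fin disj by (subst card_Un_disjoint; (subst card_Un_disjoint)?) (auto simp: card_Diff_subset)
    have "\<P>(\<omega> in M. ?F s \<omega>) = \<P>(\<omega> in M. R (fst s) (snd s) (\<lambda>n. X n \<omega>)) *
        (p ^ card (fst s \<union> snd s \<union> A) * (1 - p) ^ card ((K - fst s) \<union> (L - snd s) \<union> B))"
      using s f fin disj by (intro bernoulli_pattern_prob[OF U XU] ber R) auto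
    then show "\<P>(\<omega> in M. ?F s \<omega>) = \<P>(\<omega> in M. R (fst s) (snd s) (\<lambda>n. X n \<omega>)) *
         (p ^ (card (fst s) + card (snd s) + card A) * (1 - p) ^ (card K - card (fst s) + (card L - card (snd s)) + card B))"
      unfolding c1 c2 .
  qed simp
  finally show ?thesis by (simp add: sum.cartesian_product case_prod_unfold)
qed

end

subsection \<open>Paths of the switched sequence\<close>

text \<open>Positivity of the level matters: a switched-off index contributes 0 to the maximum,
  which is never an exceedance.\<close>

lemma Y_seq_exceeds_iff:
  assumes n: "1 \<le> n" and v: "0 < v" and bin: "U n \<omega> = 0 \<or> U n \<omega> = 1"
    and bin': "\<And>i. i < n \<Longrightarrow> U i \<omega> = 0 \<or> U i \<omega> = 1"
  shows "v < Y_seq T U X n \<omega> \<longleftrightarrow> U n \<omega> = 1 \<and> v < X n \<omega>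
    \<or> U n \<omega> = 0 \<and> (\<exists>i\<in>{(n - 1) div T * T..n - 1}. U i \<omega> = 1 \<and> v < X i \<omega>)"
proof -
  have ne: "(n - 1) div T * T \<le> n - 1" by (rule div_times_less_eq_dividend)
  have "v < (MAX i\<in>{(n - 1) div T * T..n - 1}. U i \<omega> * X i \<omega>) \<longleftrightarrow> (\<exists>i\<in>{(n - 1) div T * T..n - 1}. v < U i \<omega> * X i \<omega>)"
    using ne by (subst Max_gr_iff) auto
  also have "\<dots> \<longleftrightarrow> (\<exists>i\<in>{(n - 1) div T * T..n - 1}. U i \<omega> = 1 \<and> v < X i \<omega>)"
  proof (rule bex_cong)
    fix i assume "i \<in> {(n - 1) div T * T..n - 1}"
    then have "i < n" using n by auto
    then show "v < U i \<omega> * X i \<omega> \<longleftrightarrow> U i \<omega> = 1 \<and> v < X i \<omega>" using bin'[of i] v by auto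
  qed simp
  finally show ?thesis using bin unfolding Y_seq_def by (elim disjE) simp_all
qed

text \<open>Collects the almost sure properties of the switches at one fixed sample point, so that
  the combinatorics of exceedances is separated from probability.\<close>

locale switched_path =
  fixes T :: nat and U X :: "nat \<Rightarrow> 'a \<Rightarrow> real" and \<omega> :: 'a and v :: real
  assumes T: "2 \<le> T" and v: "0 < v" and bin: "\<And>j. U j \<omega> = 0 \<or> U j \<omega> = 1" and on: "\<And>j. U (j * T) \<omega> = 1"
begin

lemma exceeds_iff:
  assumes "1 \<le> n"
  shows "v < Y_seq T U X n \<omega> \<longleftrightarrow> U n \<omega> = 1 \<and> v < X n \<omega>
    \<or> U n \<omega> = 0 \<and> (\<exists>i\<in>{(n - 1) div T * T..n - 1}. U i \<omega> = 1 \<and> v < X i \<omega>)"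
  using assms bin v by (intro Y_seq_exceeds_iff) auto

lemma first_block:
  assumes "1 \<le> n" "n < T"
  shows "v < Y_seq T U X n \<omega> \<longleftrightarrow> U n \<omega> = 1 \<and> v < X n \<omega> \<or> U n \<omega> = 0 \<and> (\<exists>i\<in>{0..n - 1}. U i \<omega> = 1 \<and> v < X i \<omega>)"
proof -
  have eq: "(n - 1) div T * T = 0" using assms by simp
  show ?thesis unfolding exceeds_iff[OF assms(1)] eq ..
qed

lemma second_block:
  assumes "T < n" "n < 2 * T"
  shows "v < Y_seq T U X n \<omega> \<longleftrightarrow> U n \<omega> = 1 \<and> v < X n \<omega> \<or> U n \<omega> = 0 \<and> (\<exists>i\<in>{T..n - 1}. U i \<omega> = 1 \<and> v < X i \<omega>)"
proof -
  have "(n - 1) div T = 1" using assms by (intro div_nat_eqI) auto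
  then show ?thesis using assms exceeds_iff[of n] T by simp
qed

lemma at_T: "v < Y_seq T U X T \<omega> \<longleftrightarrow> v < X T \<omega>"
  using exceeds_iff[of T] on[of 1] T by simp

text \<open>Either the switch is on and Y takes its own X value, or an earlier value of the period
  is repeated. At multiples of \<open>T\<close> the switch is always on, which leaves only the first
  case.\<close>

lemma exceeds_source:
  assumes "1 \<le> n" "v < Y_seq T U X n \<omega>"
  obtains i where "(n - 1) div T * T \<le> i" "i \<le> n" "v < X i \<omega>" "T dvd n \<Longrightarrow> i = n"
proof -
  have "U n \<omega> = 1" if "T dvd n" using on that by (metis dvd_div_mult_self)
  have ne: "(n - 1) div T * T \<le> n - 1" by (rule div_times_less_eq_dividend)
  from assms(2)[unfolded exceeds_iff[OF assms(1)]] show ?thesis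
  proof (elim disjE conjE bexE)
    assume "U n \<omega> = 1" "v < X n \<omega>"
    moreover have "(n - 1) div T * T \<le> n" using ne by linarith
    ultimately show thesis using that[of n] by simp
  next
    fix i assume "U n \<omega> = 0" "i \<in> {(n - 1) div T * T..n - 1}" "v < X i \<omega>"
    moreover have "\<not> T dvd n" using \<open>T dvd n \<Longrightarrow> U n \<omega> = 1\<close> \<open>U n \<omega> = 0\<close> by auto
    ultimately show thesis using that[of i] by auto
  qed
qed

text \<open>An exceedance at \<open>i\<close> has a source at or before \<open>i\<close> in the
  first period, and any later off switch before \<open>T\<close> would repeat it; so these switches
  must all be on, and Y agrees with X there. At \<open>T\<close> the running maximum restarts. From
  then on an off switch only repeats values already below the level, so only the on indices are
  constrained.\<close>

lemma cluster_end_iff: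
  assumes i: "1 \<le> i" "i < T"
  shows "v < Y_seq T U X i \<omega> \<and> (\<forall>j\<in>{i + 1..i + T - 1}. Y_seq T U X j \<omega> \<le> v) \<longleftrightarrow>
    (U i \<omega> = 1 \<and> v < X i \<omega> \<or> U i \<omega> = 0 \<and> (\<exists>m\<in>{0..i - 1}. U m \<omega> = 1 \<and> v < X m \<omega>))
     \<and> (\<forall>j\<in>{i + 1..T - 1}. U j \<omega> = 1) \<and> (\<forall>j\<in>{i + 1..T}. X j \<omega> \<le> v)
     \<and> (\<forall>j\<in>{T + 1..T + i - 1}. U j \<omega> = 1 \<longrightarrow> X j \<omega> \<le> v)"
  (is "?Y \<and> ?C \<longleftrightarrow> ?S \<and> ?O \<and> ?A \<and> ?B")
proof
  assume YC: "?Y \<and> ?C"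
  then have S: ?S using first_block[OF i] by simp
  obtain m where m: "m \<le> i" "U m \<omega> = 1" "v < X m \<omega>"
    using S
  proof (elim disjE conjE bexE)
    fix m assume "m \<in> {0..i - 1}" "U m \<omega> = 1" "v < X m \<omega>"
    then show thesis using that[of m] by auto
  qed (use that in blast)
  have O: "U j \<omega> = 1" if j: "j \<in> {i + 1..T - 1}" for j
  proof (rule ccontr)
    assume "U j \<omega> \<noteq> 1"
    then have "U j \<omega> = 0" using bin by blast
    moreover have "m \<in> {0..j - 1}" using m j by auto
    moreover have "1 \<le> j" "j < T" using j T by auto
    ultimately have "v < Y_seq T U X j \<omega>" using first_block[of j] m by blast
    moreover have "j \<in> {i + 1..i + T - 1}" using j i by auto
    ultimately show False using YC by force
  qed
  have A: "X j \<omega> \<le> v" if j: "j \<in> {i + 1..T}" for j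
  proof -
    have "j \<in> {i + 1..i + T - 1}" using j i by auto
    then have "\<not> v < Y_seq T U X j \<omega>" using YC by force
    moreover have "j \<in> {i + 1..T - 1}" "1 \<le> j" "j < T" if "j \<noteq> T" using j that by auto
    ultimately show ?thesis using at_T first_block[of j] O[of j] by (cases "j = T") auto
  qed
  have B: "X j \<omega> \<le> v" if j: "j \<in> {T + 1..T + i - 1}" "U j \<omega> = 1" for j
  proof -
    have "j \<in> {i + 1..i + T - 1}" using j i by auto
    then have "\<not> v < Y_seq T U X j \<omega>" using YC by force
    moreover have "T < j" "j < 2 * T" using j i by auto
    ultimately show ?thesis using second_block[of j] j by auto
  qed
  show "?S \<and> ?O \<and> ?A \<and> ?B" using S O A B by blast
next
  assume R: "?S \<and> ?O \<and> ?A \<and> ?B"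
  then have ?Y using first_block[OF i] by simp
  moreover have "Y_seq T U X j \<omega> \<le> v" if j: "j \<in> {i + 1..i + T - 1}" for j
  proof -
    consider "j \<in> {i + 1..T - 1}" | "j = T" | "j \<in> {T + 1..T + i - 1}"
      using j i by fastforce
    then have "\<not> v < Y_seq T U X j \<omega>"
    proof cases
      case 1
      then have "U j \<omega> = 1" "X j \<omega> \<le> v" using R by auto
      moreover have "1 \<le> j" "j < T" using 1 i by auto
      ultimately show ?thesis using first_block[of j] by auto
    next
      case 2
      have "X T \<omega> \<le> v" using R i by auto
      then show ?thesis unfolding 2 at_T by simp
    next
      case 3
      have "X m \<omega> \<le> v" if "m \<in> {T..j}" "U m \<omega> = 1" for m
      proof (cases "m = T")
        case True then show ?thesis using R i by auto
      next
        case False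
        then have "m \<in> {T + 1..T + i - 1}" using that 3 by auto
        then show ?thesis using R that by blast
      qed
      then have "\<not> (U m \<omega> = 1 \<and> v < X m \<omega>)" if "m \<in> {T..j}" for m using that by force
      moreover have "{T..j - 1} \<subseteq> {T..j}" "j \<in> {T..j}" "T < j" "j < 2 * T" using 3 i by auto
      ultimately show ?thesis using second_block[of j] by blast
    qed
    then show ?thesis by simp
  qed
  ultimately show "?Y \<and> ?C" by blast
qed

text \<open>Here the exceedance sits at the start of a period, so each of the following
  \<open>T - 1\<close> switches would repeat it if off. No free switches are left, and this residue
  contributes nothing to the P* terms.\<close>

lemma cluster_end_T_iff:
  "v < Y_seq T U X T \<omega> \<and> (\<forall>j\<in>{T + 1..T + T - 1}. Y_seq T U X j \<omega> \<le> v) \<longleftrightarrow>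
    v < X T \<omega> \<and> (\<forall>j\<in>{T + 1..T + T - 1}. X j \<omega> \<le> v) \<and> (\<forall>j\<in>{T + 1..T + T - 1}. U j \<omega> = 1)"
proof -
  have "Y_seq T U X j \<omega> \<le> v \<longleftrightarrow> X j \<omega> \<le> v \<and> U j \<omega> = 1" if j: "j \<in> {T + 1..T + T - 1}" and x: "v < X T \<omega>" for j
  proof -
    have "T \<in> {T..j - 1}" "T < j" "j < 2 * T" using j by auto
    moreover have "U T \<omega> = 1" using on[of 1] by simp
    ultimately have "v < Y_seq T U X j \<omega> \<longleftrightarrow> U j \<omega> = 1 \<and> v < X j \<omega> \<or> U j \<omega> = 0"
      using second_block[of j] x by blast
    then show ?thesis using bin[of j] by (auto simp: not_less[symmetric])
  qed
  then show ?thesis unfolding at_T by blast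
qed

text \<open>The late exceedance lies after \<open>T\<close>, so its source is at least
  \<open>T\<close>; the point is to exclude \<open>T\<close> itself. If \<open>i < T\<close>, then
  \<open>T\<close> lies in the quiet window. If \<open>i = T\<close>, the source lies in a period
  starting at \<open>2 * T\<close> or later, except for \<open>j = 2 * T\<close>, where the switch
  is on and the source is \<open>j\<close>.\<close>

lemma cluster_gap_source:
  assumes i: "i \<in> {1..T}"
    and c: "v < Y_seq T U X i \<omega>" "\<forall>j\<in>{i + 1..i + T - 1}. Y_seq T U X j \<omega> \<le> v" "\<exists>j\<in>{i + T..r}. v < Y_seq T U X j \<omega>"
  shows "(\<exists>j\<in>{0..T}. v < X j \<omega>) \<and> (\<exists>j\<in>{T + 1..r + T}. v < X j \<omega>)"
proof
  show "\<exists>j\<in>{0..T}. v < X j \<omega>"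
    using exceeds_source[OF _ c(1)] i by (metis atLeastAtMost_iff le_trans zero_le)
  obtain j where j: "j \<in> {i + T..r}" "v < Y_seq T U X j \<omega>" using c(3) by blast
  then have j1: "1 \<le> j" using i by auto
  obtain m where m: "(j - 1) div T * T \<le> m" "m \<le> j" "v < X m \<omega>" "T dvd j \<Longrightarrow> m = j"
    using exceeds_source[OF j1 j(2)] by blast
  have "T \<le> j - 1" using j i by auto
  then have "1 \<le> (j - 1) div T" using T by (simp add: less_eq_div_iff_mult_less_eq)
  then have "T \<le> m" using m(1) by (metis le_trans mult_le_mono1 nat_mult_1)
  moreover have "m \<noteq> T"
  proof (cases "i = T")
    case True
    show ?thesis
    proof (cases "j = 2 * T")
      case True then show ?thesis using m(4) T by simp
    next
      case False
      then have "2 * T \<le> j - 1" using j True by auto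
      then have "2 \<le> (j - 1) div T" using T by (simp add: less_eq_div_iff_mult_less_eq)
      then have "2 * T \<le> m" using m(1) by (metis le_trans mult_le_mono1)
      then show ?thesis using T by simp
    qed
  next
    case False
    then have "T \<in> {i + 1..i + T - 1}" using i by auto
    then have "\<not> v < X T \<omega>" using c(2) at_T by force
    then show ?thesis using m(3) by blast
  qed
  ultimately have "m \<in> {T + 1..r + T}" using m(2) j(1) by auto
  then show "\<exists>j\<in>{T + 1..r + T}. v < X j \<omega>" using m(3) by blast
qed

end

subsection \<open>Cluster probabilities of the switched sequence\<close>

lemma (in prob_space) tail_cdf:
  assumes [measurable]: "Z \<in> borel_measurable M"
  shows "1 - cdf (distr M borel Z) v = \<P>(\<omega> in M. v < Z \<omega>)"
proof -
  have "cdf (distr M borel Z) v = \<P>(\<omega> in M. Z \<omega> \<le> v)"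
    unfolding cdf_def by (subst measure_distr) (auto simp: vimage_def Int_def conj_commute)
  then have "1 - cdf (distr M borel Z) v = \<P>(\<omega> in M. \<not> Z \<omega> \<le> v)"
    by (subst prob_neg) auto
  then show ?thesis by (simp add: not_le)
qed

locale switched_sequence = prob_space M for M :: "'a measure" +
  fixes T :: nat and p :: real and U X :: "nat \<Rightarrow> 'a \<Rightarrow> real"
  assumes T: "2 \<le> T" and p: "0 < p" "p < 1"
    and U_indep: "indep_vars (\<lambda>_. borel) U UNIV"
    and U_on: "\<And>j. AE \<omega> in M. U (j * T) \<omega> = 1"
    and U_distr: "\<And>n. \<not> T dvd n \<Longrightarrow>
           distr M borel (U n) = distr (measure_pmf (bernoulli_pmf p)) borel (of_bool :: bool \<Rightarrow> real)"
    and X_meas [measurable]: "\<And>n. X n \<in> borel_measurable M"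
    and X_stationary: "strictly_stationary M X"
    and XU_indep: "indep_var (\<Pi>\<^sub>M i\<in>UNIV. borel) (\<lambda>\<omega> n. X n \<omega>) (\<Pi>\<^sub>M i\<in>UNIV. borel) (\<lambda>\<omega> n. U n \<omega>)"
begin

lemma U_meas [measurable]: "U n \<in> borel_measurable M"
  using U_indep unfolding indep_vars_def by blast

abbreviation Y :: "nat \<Rightarrow> 'a \<Rightarrow> real" where "Y \<equiv> Y_seq T U X"

lemma Y_meas [measurable]: "Y n \<in> borel_measurable M"
  by (intro Y_seq_measurable) measurable

lemma U_prob:
  assumes "\<not> T dvd j" "B \<in> sets borel"
  shows "\<P>(\<omega> in M. U j \<omega> \<in> B) = measure_pmf.prob (bernoulli_pmf p) {b. of_bool b \<in> B}"
proof -
  have "{\<omega> \<in> space M. U j \<omega> \<in> B} = U j -` B \<inter> space M" by auto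
  then have "\<P>(\<omega> in M. U j \<omega> \<in> B) = measure (distr M borel (U j)) B"
    using assms(2) by (simp add: measure_distr)
  also have "\<dots> = measure_pmf.prob (bernoulli_pmf p) {b. of_bool b \<in> B}"
    unfolding U_distr[OF assms(1)] using assms(2) by (subst measure_distr) (auto simp: vimage_def)
  finally show ?thesis .
qed

lemma U_prob_1: "\<not> T dvd j \<Longrightarrow> \<P>(\<omega> in M. U j \<omega> = 1) = p"
proof -
  assume "\<not> T dvd j"
  moreover have "{b. of_bool b \<in> {1::real}} = {True}" by auto
  ultimately show ?thesis using U_prob[of j "{1}"] p by (simp add: measure_pmf_single)
qed

lemma U_prob_0: "\<not> T dvd j \<Longrightarrow> \<P>(\<omega> in M. U j \<omega> = 0) = 1 - p"
proof -
  assume "\<not> T dvd j"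
  moreover have "{b. of_bool b \<in> {0::real}} = {False}" by auto
  ultimately show ?thesis using U_prob[of j "{0}"] p by (simp add: measure_pmf_single)
qed

lemma AE_switched_path: "0 < v \<Longrightarrow> AE \<omega> in M. switched_path T U \<omega> v"
proof -
  assume v: "0 < v"
  have "AE \<omega> in M. U j \<omega> = 0 \<or> U j \<omega> = 1" for j
  proof (cases "T dvd j")
    case True
    then obtain i where "j = i * T" by (metis dvd_div_mult_self)
    then show ?thesis using U_on[of i] by auto
  next
    case False
    have "{b. of_bool b \<in> {0::real, 1}} = UNIV" by auto
    then have "\<P>(\<omega> in M. U j \<omega> \<in> {0, 1}) = 1"
      using U_prob[OF False, of "{0, 1}"] by simp
    then have "AE \<omega> in M. U j \<omega> \<in> {0, 1}" by (subst (asm) prob_Collect_eq_1) auto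
    then show ?thesis by simp
  qed
  then have "AE \<omega> in M. \<forall>j. U j \<omega> = 0 \<or> U j \<omega> = 1" by (simp add: AE_all_countable)
  moreover have "AE \<omega> in M. \<forall>j. U (j * T) \<omega> = 1" using U_on by (simp add: AE_all_countable)
  ultimately show ?thesis
    by eventually_elim (use T v in \<open>unfold_locales, auto\<close>)
qed

lemma AE_U_binary: "AE \<omega> in M. \<forall>j. U j \<omega> = 0 \<or> U j \<omega> = 1"
  using AE_switched_path[OF zero_less_one] by eventually_elim (simp add: switched_path_def)

lemma Y_threshold_periodic: "threshold_periodic Y T v"
proof (rule Y_seq_threshold_periodic[OF X_meas X_stationary U_indep _ XU_indep])
  fix i c
  show "distr M borel (U (i + c * T)) = distr M borel (U i)"
  proof (cases "T dvd i")
    case True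
    then obtain j where j: "i = j * T" by (metis dvd_div_mult_self)
    have "AE \<omega> in M. U ((j + c) * T) \<omega> = U (j * T) \<omega>"
      using U_on[of "j + c"] U_on[of j] by eventually_elim simp
    then show ?thesis unfolding j by (intro distr_cong_AE) (simp_all add: add_mult_distrib)
  next
    case False
    then have "\<not> T dvd i + c * T" by (simp add: dvd_add_left_iff)
    then show ?thesis using U_distr False by simp
  qed
qed (use T in simp)

lemma pattern_sum:
  assumes "\<And>j. j \<in> K \<union> L \<union> A \<union> B \<Longrightarrow> \<not> T dvd j"
    and "finite K" "finite L" "finite A" "finite B"
    and "K \<inter> L = {}" "K \<inter> A = {}" "K \<inter> B = {}" "L \<inter> A = {}" "L \<inter> B = {}" "A \<inter> B = {}"
    and "\<And>J I. Measurable.pred (\<Pi>\<^sub>M i\<in>UNIV. borel) (R J I)"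
  shows "\<P>(\<omega> in M. R {j\<in>K. U j \<omega> = 1} {j\<in>L. U j \<omega> = 1} (\<lambda>n. X n \<omega>) \<and> (\<forall>j\<in>A. U j \<omega> = 1) \<and> (\<forall>j\<in>B. U j \<omega> = 0))
    = (\<Sum>J\<in>Pow K. \<Sum>I\<in>Pow L. \<P>(\<omega> in M. R J I (\<lambda>n. X n \<omega>)) *
         (p ^ (card J + card I + card A) * (1 - p) ^ (card K - card J + (card L - card I) + card B)))"
  by (rule bernoulli_pattern_sum[OF U_indep XU_indep U_prob_1 U_prob_0 AE_U_binary]) (use assms in blast)+

lemma not_dvd_first_block: "1 \<le> j \<Longrightarrow> j < T \<Longrightarrow> \<not> T dvd j"
  by (auto dest: dvd_imp_le)

lemma not_dvd_second_block: "T < j \<Longrightarrow> j < 2 * T \<Longrightarrow> \<not> T dvd j"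
  using not_dvd_first_block[of "j - T"] by (simp add: dvd_minus_self)

text \<open>Split by the switch at \<open>j\<close>. If it is off, the event depends on earlier
  switches and on X. Expanding over the on-sets before \<open>j\<close> shows that the off switch
  multiplies every term by the same factor \<open>1 - p\<close>, so the sum folds back into one
  probability.\<close>

lemma Y_exceedance_prob:
  assumes j: "1 \<le> j" "j < T" and v: "0 < v"
  shows "\<P>(\<omega> in M. v < Y j \<omega>) = p * \<P>(\<omega> in M. v < X j \<omega>)
     + (1 - p) * \<P>(\<omega> in M. \<exists>m\<in>{0..j - 1}. U m \<omega> = 1 \<and> v < X m \<omega>)"
proof -
  let ?K = "S_lower j"
  let ?R = "\<lambda>(J :: nat set) (I :: nat set) (x :: nat \<Rightarrow> real). \<exists>m\<in>J \<union> {0}. v < x m"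
  have K: "?K = {1..<j}" "finite ?K" unfolding S_lower_def using j by auto
  have R: "Measurable.pred (\<Pi>\<^sub>M i\<in>UNIV. borel) (?R J I)" for J I by measurable
  have U0: "AE \<omega> in M. U 0 \<omega> = 1" using U_on[of 0] by simp
  have low: "(\<exists>m\<in>{0..j - 1}. U m \<omega> = 1 \<and> v < X m \<omega>) \<longleftrightarrow> ?R {m\<in>?K. U m \<omega> = 1} {m\<in>{}. U m \<omega> = 1} (\<lambda>n. X n \<omega>)"
    if "U 0 \<omega> = 1" for \<omega>
  proof -
    have eq: "{0..j - 1} = insert 0 ?K" using j unfolding K by auto
    show ?thesis unfolding eq using that by blast
  qed
  have ev [measurable]: "Measurable.pred M (\<lambda>\<omega>. ?R {m\<in>?K. U m \<omega> = 1} {m\<in>{}. U m \<omega> = 1} (\<lambda>n. X n \<omega>))"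
    by (rule pred_random_index[where R = "\<lambda>J \<omega>. ?R J {m\<in>{}. U m \<omega> = 1} (\<lambda>n. X n \<omega>)", OF K(2)]) measurable
  have low_prob: "\<P>(\<omega> in M. \<exists>m\<in>{0..j - 1}. U m \<omega> = 1 \<and> v < X m \<omega>)
     = \<P>(\<omega> in M. ?R {m\<in>?K. U m \<omega> = 1} {m\<in>{}. U m \<omega> = 1} (\<lambda>n. X n \<omega>) \<and> (\<forall>j\<in>{}. U j \<omega> = 1) \<and> (\<forall>j\<in>{}. U j \<omega> = 0))"
  proof (rule prob_eq_AE)
    show "AE \<omega> in M. (\<exists>m\<in>{0..j - 1}. U m \<omega> = 1 \<and> v < X m \<omega>) \<longleftrightarrow>
      ?R {m\<in>?K. U m \<omega> = 1} {m\<in>{}. U m \<omega> = 1} (\<lambda>n. X n \<omega>) \<and> (\<forall>j\<in>{}. U j \<omega> = 1) \<and> (\<forall>j\<in>{}. U j \<omega> = 0)"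
      using U0
    proof eventually_elim
      case (elim \<omega>)
      show ?case unfolding low[OF elim] by blast
    qed
  qed measurable
  also have "\<dots> = (\<Sum>J\<in>Pow ?K. \<P>(\<omega> in M. ?R J {} (\<lambda>n. X n \<omega>)) * (p ^ card J * (1 - p) ^ (card ?K - card J)))"
    by (subst pattern_sum[where R = ?R]) (use K R j not_dvd_first_block in auto)
  finally have low_sum: "\<P>(\<omega> in M. \<exists>m\<in>{0..j - 1}. U m \<omega> = 1 \<and> v < X m \<omega>) = \<dots>" .
  have off: "\<P>(\<omega> in M. ?R {m\<in>?K. U m \<omega> = 1} {m\<in>{}. U m \<omega> = 1} (\<lambda>n. X n \<omega>) \<and> (\<forall>j\<in>{}. U j \<omega> = 1) \<and> (\<forall>i\<in>{j}. U i \<omega> = 0))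
     = (\<Sum>J\<in>Pow ?K. \<P>(\<omega> in M. ?R J {} (\<lambda>n. X n \<omega>)) * (p ^ card J * (1 - p) ^ (card ?K - card J + 1)))"
    by (subst pattern_sum[where R = ?R]) (use K R j not_dvd_first_block in auto)
  have on: "\<P>(\<omega> in M. v < X j \<omega> \<and> (\<forall>i\<in>{j}. U i \<omega> = 1) \<and> (\<forall>i\<in>{}. U i \<omega> = 0)) = \<P>(\<omega> in M. v < X j \<omega>) * p"
    by (subst pattern_sum[where R = "\<lambda>_ _ x. v < x j" and K = "{}" and L = "{}", simplified])
       (use j not_dvd_first_block in auto)
  let ?E1 = "{\<omega> \<in> space M. v < X j \<omega> \<and> (\<forall>i\<in>{j}. U i \<omega> = 1) \<and> (\<forall>i\<in>{}. U i \<omega> = 0)}"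
  let ?E0 = "{\<omega> \<in> space M. ?R {m\<in>?K. U m \<omega> = 1} {m\<in>{}. U m \<omega> = 1} (\<lambda>n. X n \<omega>) \<and> (\<forall>j\<in>{}. U j \<omega> = 1) \<and> (\<forall>i\<in>{j}. U i \<omega> = 0)}"
  have "\<P>(\<omega> in M. v < Y j \<omega>) = prob (?E1 \<union> ?E0)"
  proof (rule finite_measure_eq_AE)
    show "AE \<omega> in M. \<omega> \<in> {\<omega> \<in> space M. v < Y j \<omega>} \<longleftrightarrow> \<omega> \<in> ?E1 \<union> ?E0"
      using AE_switched_path[OF v] U0 AE_space
    proof eventually_elim
      case (elim \<omega>)
      show ?case using switched_path.first_block[OF elim(1) j, of X] low[OF elim(2)] elim(3) by blast
    qed
  qed auto
  also have "\<dots> = prob ?E1 + prob ?E0"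
    by (intro finite_measure_Union) auto
  finally show ?thesis unfolding on off low_sum
    by (simp add: sum_distrib_left mult_ac)
qed


text \<open>Identifies the tails of the distribution functions G_j with the probabilities in
  \<open>Y_exceedance_prob\<close>; this is how the limits \<tau>_j enter the intensity of
  Y.\<close>

lemma running_max_tail:
  assumes v: "0 < v" and j: "1 \<le> j"
  shows "1 - cdf (distr M borel (\<lambda>\<omega>. MAX i\<in>{0..j - 1}. U i \<omega> * X i \<omega>)) v
    = \<P>(\<omega> in M. \<exists>m\<in>{0..j - 1}. U m \<omega> = 1 \<and> v < X m \<omega>)"
proof -
  let ?m = "\<lambda>\<omega>. MAX i\<in>{0..j - 1}. U i \<omega> * X i \<omega>"
  have m [measurable]: "?m \<in> borel_measurable M" by (intro borel_measurable_Max) auto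
  have "1 - cdf (distr M borel ?m) v = \<P>(\<omega> in M. v < ?m \<omega>)"
    by (rule tail_cdf[OF m])
  also have "\<dots> = \<P>(\<omega> in M. \<exists>m\<in>{0..j - 1}. U m \<omega> = 1 \<and> v < X m \<omega>)"
  proof (rule prob_eq_AE)
    show "AE \<omega> in M. v < ?m \<omega> \<longleftrightarrow> (\<exists>m\<in>{0..j - 1}. U m \<omega> = 1 \<and> v < X m \<omega>)"
      using AE_U_binary
    proof eventually_elim
      case (elim \<omega>)
      have "(v < U m \<omega> * X m \<omega>) = (U m \<omega> = 1 \<and> v < X m \<omega>)" for m
        using elim[THEN spec, of m] v by auto
      moreover have "v < ?m \<omega> \<longleftrightarrow> (\<exists>m\<in>{0..j - 1}. v < U m \<omega> * X m \<omega>)"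
        by (subst Max_gr_iff) auto
      ultimately show ?case by simp
    qed
  qed measurable
  finally show ?thesis .
qed

lemma Y_cluster_prob_T:
  assumes v: "0 < v"
  shows "\<P>(\<omega> in M. v < Y T \<omega> \<and> (\<forall>j\<in>{T + 1..T + T - 1}. Y j \<omega> \<le> v))
    = \<P>(\<omega> in M. v < X T \<omega> \<and> (\<forall>j\<in>{T + 1..T + T - 1}. X j \<omega> \<le> v)) * p ^ (T - 1)"
proof -
  let ?A = "{T + 1..T + T - 1}"
  have "\<P>(\<omega> in M. v < Y T \<omega> \<and> (\<forall>j\<in>?A. Y j \<omega> \<le> v))
    = \<P>(\<omega> in M. (v < X T \<omega> \<and> (\<forall>j\<in>?A. X j \<omega> \<le> v)) \<and> (\<forall>j\<in>?A. U j \<omega> = 1) \<and> (\<forall>j\<in>{}. U j \<omega> = 0))"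
  proof (rule prob_eq_AE)
    show "AE \<omega> in M. (v < Y T \<omega> \<and> (\<forall>j\<in>?A. Y j \<omega> \<le> v)) \<longleftrightarrow>
      (v < X T \<omega> \<and> (\<forall>j\<in>?A. X j \<omega> \<le> v)) \<and> (\<forall>j\<in>?A. U j \<omega> = 1) \<and> (\<forall>j\<in>{}. U j \<omega> = 0)"
      using AE_switched_path[OF v]
    proof eventually_elim
      case (elim \<omega>)
      show ?case unfolding switched_path.cluster_end_T_iff[OF elim] by blast
    qed
  qed measurable
  also have "\<dots> = \<P>(\<omega> in M. v < X T \<omega> \<and> (\<forall>j\<in>?A. X j \<omega> \<le> v)) * (p ^ card ?A * (1 - p) ^ card ({} :: nat set))"
  proof (rule bernoulli_pattern_prob[where R = "\<lambda>x. v < x T \<and> (\<forall>j\<in>?A. x j \<le> v)", OF U_indep XU_indep U_prob_1 U_prob_0])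
    show "\<not> T dvd j" if "j \<in> ?A \<union> {}" for j using that by (intro not_dvd_second_block) auto
    then show "\<not> T dvd j" if "j \<in> ?A \<union> {}" for j using that by blast
  qed (simp_all, measurable)
  finally show ?thesis by simp
qed

text \<open>Split \<open>cluster_end_iff\<close> by the switch at \<open>i\<close> and expand over
  the free switches. If it is off, the exceedance comes from a source in
  \<open>J \<union> {0}\<close>, which gives the double sum of P*. If it is on, the term with all
  switches of \<open>S_upper\<close> on is the cluster end of X itself with weight
  \<open>p ^ (T - 1)\<close>, and the proper subsets give the first sum of P*.\<close>

lemma Y_cluster_prob:
  assumes i: "1 \<le> i" "i < T" and v: "0 < u n"
  shows "real n * \<P>(\<omega> in M. u n < Y i \<omega> \<and> (\<forall>j\<in>{i + 1..i + T - 1}. Y j \<omega> \<le> u n))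
    = real n * \<P>(\<omega> in M. u n < X i \<omega> \<and> (\<forall>j\<in>{i + 1..i + T - 1}. X j \<omega> \<le> u n)) * p ^ (T - 1)
      + P_star_seq M X u p T i n"
proof -
  let ?v = "u n"
  let ?K = "S_lower i" and ?L = "S_upper T i" and ?S = "S_mid T i"
  have fin: "finite ?K" "finite ?L" by (simp_all add: S_lower_def S_upper_def)
  have cards: "card ?K = i - 1" "card ?L = i - 1" by (simp_all add: S_lower_def S_upper_def)
  let ?R1 = "\<lambda>(J :: nat set) (I :: nat set) (x :: nat \<Rightarrow> real). ?v < x i \<and> (\<forall>j\<in>?S \<union> I. x j \<le> ?v)"
  let ?R0 = "\<lambda>(J :: nat set) (I :: nat set) (x :: nat \<Rightarrow> real). (\<exists>m\<in>J \<union> {0}. ?v < x m) \<and> (\<forall>j\<in>?S \<union> I. x j \<le> ?v)"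
  have R1: "Measurable.pred (\<Pi>\<^sub>M i\<in>UNIV. borel) (?R1 J I)" for J I by measurable
  have R0: "Measurable.pred (\<Pi>\<^sub>M i\<in>UNIV. borel) (?R0 J I)" for J I by measurable
  \<comment> \<open>With \<open>U i = 1\<close> the event does not involve the switches before
    \<open>i\<close>, so the first family of free switches is empty.\<close>
  let ?P1 = "\<lambda>\<omega>. ?R1 {j\<in>{}. U j \<omega> = 1} {j\<in>?L. U j \<omega> = 1} (\<lambda>n. X n \<omega>) \<and> (\<forall>j\<in>{i..T - 1}. U j \<omega> = 1) \<and> (\<forall>j\<in>{}. U j \<omega> = 0)"
  let ?P0 = "\<lambda>\<omega>. ?R0 {j\<in>?K. U j \<omega> = 1} {j\<in>?L. U j \<omega> = 1} (\<lambda>n. X n \<omega>) \<and> (\<forall>j\<in>{i + 1..T - 1}. U j \<omega> = 1) \<and> (\<forall>j\<in>{i}. U j \<omega> = 0)"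
  have meas1: "Measurable.pred M (\<lambda>\<omega>. ?R1 {j\<in>{}. U j \<omega> = 1} {j\<in>?L. U j \<omega> = 1} (\<lambda>n. X n \<omega>))"
    by (rule pred_random_index[where R = "\<lambda>I \<omega>. ?R1 {j\<in>{}. U j \<omega> = 1} I (\<lambda>n. X n \<omega>)", OF fin(2)]) measurable
  have meas0': "Measurable.pred M (\<lambda>\<omega>. ?R0 J {j\<in>?L. U j \<omega> = 1} (\<lambda>n. X n \<omega>))" for J
    by (rule pred_random_index[where R = "\<lambda>I \<omega>. ?R0 J I (\<lambda>n. X n \<omega>)", OF fin(2)]) measurable
  have meas0: "Measurable.pred M (\<lambda>\<omega>. ?R0 {j\<in>?K. U j \<omega> = 1} {j\<in>?L. U j \<omega> = 1} (\<lambda>n. X n \<omega>))"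
    by (rule pred_random_index[where R = "\<lambda>J \<omega>. ?R0 J {j\<in>?L. U j \<omega> = 1} (\<lambda>n. X n \<omega>)", OF fin(1) _ meas0']) measurable
  have E1: "{\<omega> \<in> space M. ?P1 \<omega>} \<in> events"
    unfolding pred_def[symmetric] by (intro pred_intros_logic(3) meas1) measurable
  have E0: "{\<omega> \<in> space M. ?P0 \<omega>} \<in> events"
    unfolding pred_def[symmetric] by (intro pred_intros_logic(3) meas0) measurable
  have "\<P>(\<omega> in M. u n < Y i \<omega> \<and> (\<forall>j\<in>{i + 1..i + T - 1}. Y j \<omega> \<le> u n))
    = prob ({\<omega> \<in> space M. ?P1 \<omega>} \<union> {\<omega> \<in> space M. ?P0 \<omega>})"
  proof (rule finite_measure_eq_AE)
    have U0: "AE \<omega> in M. U 0 \<omega> = 1" using U_on[of 0] by simp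
    show "AE \<omega> in M. \<omega> \<in> {\<omega> \<in> space M. u n < Y i \<omega> \<and> (\<forall>j\<in>{i + 1..i + T - 1}. Y j \<omega> \<le> u n)} \<longleftrightarrow>
        \<omega> \<in> {\<omega> \<in> space M. ?P1 \<omega>} \<union> {\<omega> \<in> space M. ?P0 \<omega>}"
      using AE_switched_path[OF v] U0 AE_space
    proof eventually_elim
      case (elim \<omega>)
      have low: "(\<exists>m\<in>{0..i - 1}. U m \<omega> = 1 \<and> ?v < X m \<omega>) \<longleftrightarrow> (\<exists>m\<in>{j\<in>?K. U j \<omega> = 1} \<union> {0}. ?v < X m \<omega>)"
      proof -
        have eq: "{0..i - 1} = insert 0 ?K" unfolding S_lower_def using i by auto
        show ?thesis unfolding eq using elim(2) by blast
      qed
      have up: "(\<forall>j\<in>{i + 1..T}. X j \<omega> \<le> ?v) \<and> (\<forall>j\<in>{T + 1..T + i - 1}. U j \<omega> = 1 \<longrightarrow> X j \<omega> \<le> ?v)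
         \<longleftrightarrow> (\<forall>j\<in>?S \<union> {j\<in>?L. U j \<omega> = 1}. X j \<omega> \<le> ?v)"
        unfolding S_mid_def S_upper_def by blast
      have on: "(\<forall>j\<in>{i..T - 1}. U j \<omega> = 1) \<longleftrightarrow> U i \<omega> = 1 \<and> (\<forall>j\<in>{i + 1..T - 1}. U j \<omega> = 1)"
      proof -
        have eq: "{i..T - 1} = insert i {i + 1..T - 1}" using i by auto
        show ?thesis unfolding eq by blast
      qed
      have "(?v < Y i \<omega> \<and> (\<forall>j\<in>{i + 1..i + T - 1}. Y j \<omega> \<le> ?v)) \<longleftrightarrow> ?P1 \<omega> \<or> ?P0 \<omega>"
        unfolding switched_path.cluster_end_iff[OF elim(1) i] low up[symmetric] on by blast
      then show ?case using elim(3) by blast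
    qed
    show "{\<omega> \<in> space M. u n < Y i \<omega> \<and> (\<forall>j\<in>{i + 1..i + T - 1}. Y j \<omega> \<le> u n)} \<in> events" by measurable
  qed (rule sets.Un[OF E1 E0])
  also have "\<dots> = \<P>(\<omega> in M. ?P1 \<omega>) + \<P>(\<omega> in M. ?P0 \<omega>)"
  proof (rule finite_measure_Union[OF E1 E0])
    have "i \<in> {i..T - 1}" using i by simp
    show "{\<omega> \<in> space M. ?P1 \<omega>} \<inter> {\<omega> \<in> space M. ?P0 \<omega>} = {}"
    proof (rule equals0I)
      fix \<omega> assume "\<omega> \<in> {\<omega> \<in> space M. ?P1 \<omega>} \<inter> {\<omega> \<in> space M. ?P0 \<omega>}"
      then have "\<forall>j\<in>{i..T - 1}. U j \<omega> = 1" "\<forall>j\<in>{i}. U j \<omega> = 0" by blast+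
      then have "U i \<omega> = 1" "U i \<omega> = 0" using \<open>i \<in> {i..T - 1}\<close> by blast+
      then show False by simp
    qed
  qed
  also have "\<P>(\<omega> in M. ?P1 \<omega>) = (\<Sum>J\<in>Pow {}. \<Sum>I\<in>Pow ?L. \<P>(\<omega> in M. ?R1 J I (\<lambda>n. X n \<omega>)) *
         (p ^ (card J + card I + card {i..T - 1}) * (1 - p) ^ (card ({} :: nat set) - card J + (card ?L - card I) + card ({} :: nat set))))"
  proof (rule pattern_sum[where R = ?R1, OF _ _ fin(2) _ _ _ _ _ _ _ _ R1])
    fix j assume "j \<in> {} \<union> ?L \<union> {i..T - 1} \<union> {}"
    then have "1 \<le> j \<and> j < T \<or> T < j \<and> j < 2 * T" using i unfolding S_upper_def by auto
    then show "\<not> T dvd j" using not_dvd_first_block not_dvd_second_block by blast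
  qed (use i in \<open>auto simp: S_upper_def\<close>)
  also have "\<dots> = (\<Sum>I\<in>Pow ?L. \<P>(\<omega> in M. ?R1 {} I (\<lambda>n. X n \<omega>)) * p ^ (card I + T - i) * (1 - p) ^ (i - 1 - card I))"
    using i by (simp add: cards mult.assoc)
  \<comment> \<open>The full subset is split off; its quiet set \<open>?S \<union> ?L\<close> is the
    whole window \<open>{i + 1..i + T - 1}\<close>.\<close>
  also have "\<dots> = \<P>(\<omega> in M. ?R1 {} ?L (\<lambda>n. X n \<omega>)) * p ^ (T - 1)
     + (\<Sum>I\<in>{I. I \<subset> ?L}. \<P>(\<omega> in M. ?R1 {} I (\<lambda>n. X n \<omega>)) * p ^ (card I + T - i) * (1 - p) ^ (i - 1 - card I))"
  proof -
    have "Pow ?L = insert ?L {I. I \<subset> ?L}" by auto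
    moreover have "finite {I. I \<subset> ?L}" using fin(2) by (rule finite_subset[rotated, OF finite_Pow_iff[THEN iffD2]]) auto
    moreover have "card ?L + T - i = T - 1" "i - 1 - card ?L = 0" using i by (simp_all add: cards)
    ultimately show ?thesis by simp
  qed
  also have "?S \<union> ?L = {i + 1..i + T - 1}" using i unfolding S_mid_def S_upper_def by auto
  also have "\<P>(\<omega> in M. ?P0 \<omega>) = (\<Sum>J\<in>Pow ?K. \<Sum>I\<in>Pow ?L. \<P>(\<omega> in M. ?R0 J I (\<lambda>n. X n \<omega>)) *
         (p ^ (card J + card I + card {i + 1..T - 1}) * (1 - p) ^ (card ?K - card J + (card ?L - card I) + card {i})))"
  proof (rule pattern_sum[where R = ?R0, OF _ fin _ _ _ _ _ _ _ _ R0])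
    fix j assume "j \<in> ?K \<union> ?L \<union> {i + 1..T - 1} \<union> {i}"
    then have "1 \<le> j \<and> j < T \<or> T < j \<and> j < 2 * T" using i unfolding S_upper_def S_lower_def by auto
    then show "\<not> T dvd j" using not_dvd_first_block not_dvd_second_block by blast
  qed (use i in \<open>auto simp: S_upper_def S_lower_def\<close>)
  also have "\<dots> = (\<Sum>J\<in>Pow ?K. \<Sum>I\<in>Pow ?L. \<P>(\<omega> in M. ?R0 J I (\<lambda>n. X n \<omega>)) *
         p ^ (card I + card J + T - i - 1) * (1 - p) ^ (2 * i - 1 - card I - card J))"
  proof (intro sum.cong refl)
    fix J I assume "J \<in> Pow ?K" "I \<in> Pow ?L"
    then have c: "card J \<le> i - 1" "card I \<le> i - 1" using card_mono fin cards by (metis PowD)+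
    \<comment> \<open>The off switches number \<open>i - 1 - card J\<close> before \<open>i\<close>,
      \<open>i - 1 - card I\<close> after \<open>T\<close>, and one at \<open>i\<close>. The bounds
      in \<open>c\<close> keep the natural subtractions exact.\<close>
    have e: "card J + card I + card {i + 1..T - 1} = card I + card J + T - i - 1"
      "card ?K - card J + (card ?L - card I) + card {i} = 2 * i - 1 - card I - card J"
      using c i unfolding cards by simp_all
    show "\<P>(\<omega> in M. ?R0 J I (\<lambda>n. X n \<omega>)) *
         (p ^ (card J + card I + card {i + 1..T - 1}) * (1 - p) ^ (card ?K - card J + (card ?L - card I) + card {i}))
      = \<P>(\<omega> in M. ?R0 J I (\<lambda>n. X n \<omega>)) * p ^ (card I + card J + T - i - 1) * (1 - p) ^ (2 * i - 1 - card I - card J)"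
      unfolding e by simp
  qed
  finally show ?thesis unfolding P_star_seq_def max_over_iffs by (simp add: algebra_simps)
qed

end

subsection \<open>Limits\<close>

lemma sum_split_last:
  fixes f :: "nat \<Rightarrow> real"
  assumes "1 \<le> T"
  shows "(\<Sum>i=1..T. f i) = (\<Sum>i=1..T - 1. f i) + f T"
proof -
  have "{1..T} = insert T {1..T - 1}" using assms by auto
  then show ?thesis using assms by (simp add: add.commute)
qed

context switched_sequence
begin

lemma Y_cluster_intensity:
  assumes v: "0 < u n"
  shows "real n / real T * (\<Sum>i=1..T. \<P>(\<omega> in M. u n < Y i \<omega> \<and> (\<forall>j\<in>{i + 1..i + T - 1}. Y j \<omega> \<le> u n)))
    = real n / real T * (\<Sum>i=1..T. \<P>(\<omega> in M. u n < X i \<omega> \<and> (\<forall>j\<in>{i + 1..i + T - 1}. X j \<omega> \<le> u n))) * p ^ (T - 1)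
      + 1 / real T * (\<Sum>i=1..T - 1. P_star_seq M X u p T i n)"
proof -
  let ?y = "\<lambda>i. \<P>(\<omega> in M. u n < Y i \<omega> \<and> (\<forall>j\<in>{i + 1..i + T - 1}. Y j \<omega> \<le> u n))"
  let ?x = "\<lambda>i. \<P>(\<omega> in M. u n < X i \<omega> \<and> (\<forall>j\<in>{i + 1..i + T - 1}. X j \<omega> \<le> u n))"
  have "real n * (\<Sum>i=1..T. ?y i) = (\<Sum>i=1..T - 1. real n * ?y i) + real n * ?y T"
    using T by (subst sum_split_last) (auto simp: sum_distrib_left distrib_left)
  also have "(\<Sum>i=1..T - 1. real n * ?y i) = (\<Sum>i=1..T - 1. real n * ?x i * p ^ (T - 1) + P_star_seq M X u p T i n)"
    using T by (intro sum.cong refl Y_cluster_prob v) auto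
  also have "?y T = ?x T * p ^ (T - 1)" by (rule Y_cluster_prob_T[OF v])
  finally have "real n * (\<Sum>i=1..T. ?y i)
    = real n * (\<Sum>i=1..T. ?x i) * p ^ (T - 1) + (\<Sum>i=1..T - 1. P_star_seq M X u p T i n)"
    using T by (subst sum_split_last) (auto simp: sum_distrib_left sum_distrib_right sum.distrib algebra_simps)
  from arg_cong[OF this, of "\<lambda>z. z / real T"] show ?thesis by (simp add: add_divide_distrib)
qed

lemma Y_intensity_limit:
  assumes u: "\<And>n. 1 \<le> n \<Longrightarrow> 0 < u n"
    and X: "(\<lambda>n. real n * \<P>(\<omega> in M. u n < X 0 \<omega>)) \<longlonglongrightarrow> \<tau>X"
    and max: "\<And>j. 2 \<le> j \<Longrightarrow> j \<le> T - 1 \<Longrightarrow>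
           (\<lambda>n. real n * (1 - cdf (distr M borel (\<lambda>\<omega>. MAX i\<in>{0..j - 1}. U i \<omega> * X i \<omega>)) (u n))) \<longlonglongrightarrow> \<tau>s j"
  shows "(\<lambda>n. real n / real T * (\<Sum>j=1..T. \<P>(\<omega> in M. u n < Y j \<omega>)))
    \<longlonglongrightarrow> 1 / real T * (((real T - 2) * p + 2) * \<tau>X + (1 - p) * (\<Sum>j=2..T - 1. \<tau>s j))"
proof -
  \<comment> \<open>For \<open>j = 1\<close> the running maximum is almost surely
    \<open>X 0\<close>, so its limit is \<open>\<tau>X\<close>. Residue \<open>T\<close> also
    contributes \<open>\<tau>X\<close>. The total weight of \<open>\<tau>X\<close> is therefore (T -
    1)p + (1 - p) + 1 = (T - 2)p + 2.\<close>
  define \<sigma> where "\<sigma> j = (if j = 1 then \<tau>X else \<tau>s j)" for j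
  let ?x = "\<lambda>n. \<P>(\<omega> in M. u n < X 0 \<omega>)"
  let ?m = "\<lambda>j n. \<P>(\<omega> in M. \<exists>m\<in>{0..j - 1}. U m \<omega> = 1 \<and> u n < X m \<omega>)"
  have Xj: "\<P>(\<omega> in M. u n < X j \<omega>) = ?x n" for j n
    by (rule stationary_single[OF X_stationary X_meas])
  have m: "(\<lambda>n. real n * ?m j n) \<longlonglongrightarrow> \<sigma> j" if j: "j \<in> {1..T - 1}" for j
  proof (cases "j = 1")
    case True
    have "?m 1 n = ?x n" for n
    proof (rule prob_eq_AE)
      have "AE \<omega> in M. U 0 \<omega> = 1" using U_on[of 0] by simp
      then show "AE \<omega> in M. (\<exists>m\<in>{0..1 - 1}. U m \<omega> = 1 \<and> u n < X m \<omega>) \<longleftrightarrow> u n < X 0 \<omega>"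
        by eventually_elim simp
    qed measurable
    then show ?thesis using X True unfolding \<sigma>_def by simp
  next
    case False
    then have "2 \<le> j" "j \<le> T - 1" using j by auto
    have "eventually (\<lambda>n. real n * (1 - cdf (distr M borel (\<lambda>\<omega>. MAX i\<in>{0..j - 1}. U i \<omega> * X i \<omega>)) (u n)) = real n * ?m j n) sequentially"
      using eventually_ge_at_top[of 1]
    proof eventually_elim
      case (elim n)
      then show ?case using running_max_tail[OF u[OF elim], of j] j by simp
    qed
    from Lim_transform_eventually[OF max[OF \<open>2 \<le> j\<close> \<open>j \<le> T - 1\<close>] this]
    show ?thesis using False unfolding \<sigma>_def by simp
  qed
  have "(\<lambda>n. 1 / real T * ((\<Sum>j=1..T - 1. p * (real n * ?x n) + (1 - p) * (real n * ?m j n)) + real n * ?x n))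
     \<longlonglongrightarrow> 1 / real T * ((\<Sum>j=1..T - 1. p * \<tau>X + (1 - p) * \<sigma> j) + \<tau>X)"
    by (intro tendsto_intros X m)
  moreover have "eventually (\<lambda>n. 1 / real T * ((\<Sum>j=1..T - 1. p * (real n * ?x n) + (1 - p) * (real n * ?m j n)) + real n * ?x n)
     = real n / real T * (\<Sum>j=1..T. \<P>(\<omega> in M. u n < Y j \<omega>))) sequentially"
    using eventually_ge_at_top[of 1]
  proof eventually_elim
    case (elim n)
    note v = u[OF elim]
    have "\<P>(\<omega> in M. u n < Y T \<omega>) = \<P>(\<omega> in M. u n < X T \<omega>)"
    proof (rule prob_eq_AE)
      show "AE \<omega> in M. u n < Y T \<omega> \<longleftrightarrow> u n < X T \<omega>"
        using AE_switched_path[OF v]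
      proof eventually_elim
        case (elim \<omega>)
        show ?case by (rule switched_path.at_T[OF elim])
      qed
    qed measurable
    then have YT: "\<P>(\<omega> in M. u n < Y T \<omega>) = ?x n" using Xj[of n T] by simp
    have "(\<Sum>j=1..T - 1. p * (real n * ?x n) + (1 - p) * (real n * ?m j n)) = (\<Sum>j=1..T - 1. real n * \<P>(\<omega> in M. u n < Y j \<omega>))"
    proof (rule sum.cong)
      fix j assume "j \<in> {1..T - 1}"
      then have j: "1 \<le> j" "j < T" using T by auto
      show "p * (real n * ?x n) + (1 - p) * (real n * ?m j n) = real n * \<P>(\<omega> in M. u n < Y j \<omega>)"
        unfolding Y_exceedance_prob[OF j v] Xj[of n j] by (simp add: algebra_simps)
    qed simp
    then show ?case using T YT by (subst sum_split_last[of T]) (auto simp: sum_distrib_left[symmetric] distrib_left)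
  qed
  ultimately have "(\<lambda>n. real n / real T * (\<Sum>j=1..T. \<P>(\<omega> in M. u n < Y j \<omega>)))
     \<longlonglongrightarrow> 1 / real T * ((\<Sum>j=1..T - 1. p * \<tau>X + (1 - p) * \<sigma> j) + \<tau>X)"
    by (rule Lim_transform_eventually)
  moreover have "(\<Sum>j=1..T - 1. p * \<tau>X + (1 - p) * \<sigma> j) + \<tau>X = ((real T - 2) * p + 2) * \<tau>X + (1 - p) * (\<Sum>j=2..T - 1. \<tau>s j)"
  proof -
    have "{1..T - 1} = insert 1 {2..T - 1}" using T by auto
    then have "(\<Sum>j=1..T - 1. \<sigma> j) = \<tau>X + (\<Sum>j=2..T - 1. \<tau>s j)"
      by (simp add: \<sigma>_def)
    moreover have "(\<Sum>j=1..T - 1. p * \<tau>X + (1 - p) * \<sigma> j) = (real T - 1) * (p * \<tau>X) + (1 - p) * (\<Sum>j=1..T - 1. \<sigma> j)"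
      using T by (simp add: sum.distrib sum_distrib_left of_nat_diff)
    ultimately show ?thesis by (simp add: algebra_simps)
  qed
  ultimately show ?thesis by simp
qed

lemma Y_gap_prob_le:
  assumes i: "i \<in> {1..T}" and v: "0 < v"
  shows "\<P>(\<omega> in M. v < Y i \<omega> \<and> (\<forall>j\<in>{i + 1..i + T - 1}. Y j \<omega> \<le> v) \<and> (\<exists>j\<in>{i + T..r}. v < Y j \<omega>))
    \<le> \<P>(\<omega> in M. (\<exists>j\<in>{0..T}. v < X j \<omega>) \<and> (\<exists>j\<in>{T + 1..r + T}. v < X j \<omega>))"
proof (rule finite_measure_mono_AE)
  show "AE \<omega> in M. \<omega> \<in> {\<omega> \<in> space M. v < Y i \<omega> \<and> (\<forall>j\<in>{i + 1..i + T - 1}. Y j \<omega> \<le> v) \<and> (\<exists>j\<in>{i + T..r}. v < Y j \<omega>)}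
    \<longrightarrow> \<omega> \<in> {\<omega> \<in> space M. (\<exists>j\<in>{0..T}. v < X j \<omega>) \<and> (\<exists>j\<in>{T + 1..r + T}. v < X j \<omega>)}"
    using AE_switched_path[OF v]
  proof eventually_elim
    case (elim \<omega>)
    show ?case using switched_path.cluster_gap_source[OF elim i, of X r] by blast
  qed
qed measurable

lemma X_gap_prob_le:
  assumes i: "i \<in> {1..T}"
  shows "\<P>(\<omega> in M. v < X i \<omega> \<and> (\<forall>j\<in>{i + 1..i + T - 1}. X j \<omega> \<le> v) \<and> (\<exists>j\<in>{i + T..r}. v < X j \<omega>))
    \<le> \<P>(\<omega> in M. (\<exists>j\<in>{0..T}. v < X j \<omega>) \<and> (\<exists>j\<in>{T + 1..r + T}. v < X j \<omega>))"
proof (rule finite_measure_mono)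
  have "i \<in> {0..T}" "{i + T..r} \<subseteq> {T + 1..r + T}" using i by auto
  then show "{\<omega> \<in> space M. v < X i \<omega> \<and> (\<forall>j\<in>{i + 1..i + T - 1}. X j \<omega> \<le> v) \<and> (\<exists>j\<in>{i + T..r}. v < X j \<omega>)}
    \<subseteq> {\<omega> \<in> space M. (\<exists>j\<in>{0..T}. v < X j \<omega>) \<and> (\<exists>j\<in>{T + 1..r + T}. v < X j \<omega>)}" by blast
qed measurable

lemma averaged_gap_limit:
  assumes lim: "(\<lambda>n. real n * b n) \<longlonglongrightarrow> 0"
    and le: "\<And>n i. 1 \<le> n \<Longrightarrow> i \<in> {1..T} \<Longrightarrow> 0 \<le> g n i \<and> g n i \<le> b n"
  shows "(\<lambda>n. real n / real T * (\<Sum>i=1..T. g n i)) \<longlonglongrightarrow> 0"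
proof (rule Lim_null_comparison[OF _ lim])
  show "eventually (\<lambda>n. norm (real n / real T * (\<Sum>i=1..T. g n i)) \<le> real n * b n) sequentially"
    using eventually_ge_at_top[of 1]
  proof eventually_elim
    case (elim n)
    have "(\<Sum>i=1..T. g n i) \<le> real T * b n"
      using sum_bounded_above[of "{1..T}" "g n" "b n"] le[OF elim] by simp
    moreover have "0 \<le> (\<Sum>i=1..T. g n i)" using le[OF elim] by (intro sum_nonneg) blast
    ultimately show ?case
      using T mult_left_mono[of "\<Sum>i=1..T. g n i" "real T * b n" "real n"] by (simp add: field_simps)
  qed
qed

end

section \<open>Transfer of the extremal index from X to Y\<close>

theorem theorem3p5:
  fixes M :: "'a measure"
    and U X :: "nat \<Rightarrow> 'a \<Rightarrow> real"
    and T :: nat and p :: real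
    and u :: "nat \<Rightarrow> real"
    and l k :: "nat \<Rightarrow> nat"
    and \<tau>X \<theta>X \<tau> :: real and \<tau>s :: "nat \<Rightarrow> real"
  assumes "prob_space M"
    and "T \<ge> 2" and "0 < p" and "p < 1"
    and "prob_space.indep_vars M (\<lambda>_. borel) U UNIV"
    and "\<And>j. AE \<omega> in M. U (j * T) \<omega> = 1"
    and "\<And>n. \<not> T dvd n \<Longrightarrow>
           distr M borel (U n) = distr (measure_pmf (bernoulli_pmf p)) borel (of_bool :: bool \<Rightarrow> real)"
    and "\<And>n. X n \<in> borel_measurable M"
    and "\<And>n. AE \<omega> in M. 0 < X n \<omega>"
    and "strictly_stationary M X"
    and "continuous_on UNIV (cdf (distr M borel (X 0)))"
    and "prob_space.indep_var M
           (\<Pi>\<^sub>M i\<in>UNIV. borel) (\<lambda>\<omega> n. X n \<omega>) (\<Pi>\<^sub>M i\<in>UNIV. borel) (\<lambda>\<omega> n. U n \<omega>)"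
    and "\<And>n. 1 \<le> n \<Longrightarrow> 0 < u n"
    and "0 < \<tau>X"
    and "(\<lambda>n. real n * (1 - cdf (distr M borel (X 0)) (u n))) \<longlonglongrightarrow> \<tau>X"
    and "\<And>j. 2 \<le> j \<Longrightarrow> j \<le> T - 1 \<Longrightarrow>
           (\<lambda>n. real n * (1 - cdf (distr M borel (\<lambda>\<omega>. MAX i\<in>{0..j - 1}. U i \<omega> * X i \<omega>)) (u n)))
             \<longlonglongrightarrow> \<tau>s j"
    and "\<tau> = 1 / real T * (((real T - 2) * p + 2) * \<tau>X + (1 - p) * (\<Sum>j=2..T - 1. \<tau>s j))"
    and "condition_D_with M X u l"
    and "condition_D_with M (Y_seq T U X) u l"
    and "\<And>n. 1 \<le> n \<Longrightarrow> 0 < k n"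
    and "filterlim k at_top sequentially"
    and "(\<lambda>n. real (k n) * real (l n) / real n) \<longlonglongrightarrow> 0"
    and "(\<lambda>n. real (k n) * mixing_coeff M X u n (l n)) \<longlonglongrightarrow> 0"
    and "(\<lambda>n. real (k n) * mixing_coeff M (Y_seq T U X) u n (l n)) \<longlonglongrightarrow> 0"
    and "has_extremal_index M X 1 u \<tau>X \<theta>X"
    and "(\<lambda>n. real n * \<P>(\<omega> in M. max_over X {0..T} \<omega> > ereal (u n)
             \<and> max_over X {T + 1..n div (k n * T) * T + T} \<omega> > ereal (u n))) \<longlonglongrightarrow> 0"
  shows "condition_D_T M (Y_seq T U X) T T u \<and>
     ((\<forall>i\<in>{1..T - 1}. convergent (P_star_seq M X u p T i)) \<longrightarrow>
        has_extremal_index M (Y_seq T U X) T u \<tau>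
          (\<tau>X / \<tau> * \<theta>X * p ^ (T - 1) + 1 / (\<tau> * real T) * (\<Sum>i=1..T - 1. P_star M X u p T i)))"
proof -
  interpret prob_space M by fact
  interpret switched_sequence M T p U X
    using assms by unfold_locales auto
  note u = \<open>\<And>n. 1 \<le> n \<Longrightarrow> 0 < u n\<close>
  let ?Y = "Y_seq T U X"
  define LX where "LX n = real n / real T * (\<Sum>i=1..T. \<P>(\<omega> in M. u n < X i \<omega> \<and> (\<forall>j\<in>{i + 1..i + T - 1}. X j \<omega> \<le> u n)))" for n
  define LY where "LY n = real n / real T * (\<Sum>i=1..T. \<P>(\<omega> in M. u n < ?Y i \<omega> \<and> (\<forall>j\<in>{i + 1..i + T - 1}. ?Y j \<omega> \<le> u n)))" for n
  have X0: "(\<lambda>n. real n * \<P>(\<omega> in M. u n < X 0 \<omega>)) \<longlonglongrightarrow> \<tau>X"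
    using \<open>(\<lambda>n. real n * (1 - cdf (distr M borel (X 0)) (u n))) \<longlonglongrightarrow> \<tau>X\<close> unfolding tail_cdf[OF X_meas] .
  have Xj: "\<P>(\<omega> in M. u n < X j \<omega>) = \<P>(\<omega> in M. u n < X 0 \<omega>)" for j n
    by (rule stationary_single[OF X_stationary X_meas])
  have X_intensity: "(\<lambda>n. real n / real T * (\<Sum>i=1..T. \<P>(\<omega> in M. u n < X i \<omega>))) \<longlonglongrightarrow> \<tau>X"
  proof -
    have "(\<Sum>i=1..T. \<P>(\<omega> in M. u n < X i \<omega>)) = (\<Sum>i=1..T. \<P>(\<omega> in M. u n < X 0 \<omega>))" for n
      by (intro sum.cong refl Xj)
    then show ?thesis using X0 T by simp
  qed
  have Y_intensity: "(\<lambda>n. real n / real T * (\<Sum>i=1..T. \<P>(\<omega> in M. u n < ?Y i \<omega>))) \<longlonglongrightarrow> \<tau>"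
    unfolding \<open>\<tau> = _\<close> by (rule Y_intensity_limit[OF u X0]) (use assms(16) in blast)+
  \<comment> \<open>As limits of multiples of tail probabilities these are nonnegative; this makes
    \<tau> positive, so that division by it is legitimate.\<close>
  have \<tau>s: "0 \<le> \<tau>s j" if "2 \<le> j" "j \<le> T - 1" for j
  proof (rule LIMSEQ_le_const[OF assms(16)[OF that]], intro exI allI impI)
    fix n :: nat assume "1 \<le> n"
    then show "0 \<le> real n * (1 - cdf (distr M borel (\<lambda>\<omega>. MAX i\<in>{0..j - 1}. U i \<omega> * X i \<omega>)) (u n))"
      using running_max_tail[OF u, of n j] that by simp
  qed
  have \<tau>_pos: "0 < \<tau>"
  proof -
    have "0 < ((real T - 2) * p + 2) * \<tau>X"
      using T p \<open>0 < \<tau>X\<close> by (intro mult_pos_pos add_nonneg_pos mult_nonneg_nonneg) auto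
    moreover have "0 \<le> (1 - p) * (\<Sum>j=2..T - 1. \<tau>s j)"
      using p \<tau>s by (intro mult_nonneg_nonneg sum_nonneg) auto
    ultimately have "0 < ((real T - 2) * p + 2) * \<tau>X + (1 - p) * (\<Sum>j=2..T - 1. \<tau>s j)"
      by (rule add_pos_nonneg)
    then show ?thesis unfolding \<open>\<tau> = _\<close> using T by simp
  qed
  have gap: "(\<lambda>n. real n * \<P>(\<omega> in M. (\<exists>j\<in>{0..T}. u n < X j \<omega>)
      \<and> (\<exists>j\<in>{T + 1..n div (k n * T) * T + T}. u n < X j \<omega>))) \<longlonglongrightarrow> 0"
    using assms(26) unfolding max_over_iffs .
  have X_gap: "(\<lambda>n. real n / real T * (\<Sum>i=1..T. \<P>(\<omega> in M. u n < X i \<omega> \<and> (\<forall>j\<in>{i+1..i+T-1}. X j \<omega> \<le> u n)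
                  \<and> (\<exists>j\<in>{i+T..n div (k n * T) * T}. u n < X j \<omega>)))) \<longlonglongrightarrow> 0"
    by (rule averaged_gap_limit[OF gap]) (use X_gap_prob_le in simp)
  have Y_gap: "(\<lambda>n. real n / real T * (\<Sum>i=1..T. \<P>(\<omega> in M. u n < ?Y i \<omega> \<and> (\<forall>j\<in>{i+1..i+T-1}. ?Y j \<omega> \<le> u n)
                  \<and> (\<exists>j\<in>{i+T..n div (k n * T) * T}. u n < ?Y j \<omega>)))) \<longlonglongrightarrow> 0"
    by (rule averaged_gap_limit[OF gap]) (use Y_gap_prob_le u in simp)
  \<comment> \<open>Obtained from the mixing of X alone; the same \<open>k\<close> then serves for
    both void probabilities.\<close>
  have kn: "(\<lambda>n. real (k n) / real n) \<longlonglongrightarrow> 0"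
    by (rule number_of_blocks_small_o[OF X_meas stationary_threshold_periodic[OF X_stationary X_meas] _ \<open>0 < \<tau>X\<close> assms(22,23)])
       (use X0 Xj[of _ 1] in simp)
  have X_void: "(\<lambda>n. \<P>(\<omega> in M. \<forall>j\<in>{1..n}. X j \<omega> \<le> u n) - exp (- LX n)) \<longlonglongrightarrow> 0"
    unfolding LX_def
    by (rule void_probability_limit[OF X_meas stationary_threshold_periodic[OF X_stationary X_meas]
          _ _ assms(21) kn assms(22,23) X_intensity X_gap]) (use T in simp_all)
  have Y_void: "(\<lambda>n. \<P>(\<omega> in M. \<forall>j\<in>{1..n}. ?Y j \<omega> \<le> u n) - exp (- LY n)) \<longlonglongrightarrow> 0"
    unfolding LY_def
    by (rule void_probability_limit[OF Y_meas Y_threshold_periodic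
          _ _ assms(21) kn assms(22,24) Y_intensity Y_gap]) (use T in simp_all)
  have D: "condition_D_T M ?Y T T u"
    unfolding condition_D_T_def max_over_iffs using assms(19,21,22,24) Y_gap by blast
  have "has_extremal_index M ?Y T u \<tau>
          (\<tau>X / \<tau> * \<theta>X * p ^ (T - 1) + 1 / (\<tau> * real T) * (\<Sum>i=1..T - 1. P_star M X u p T i))"
    if conv: "\<forall>i\<in>{1..T - 1}. convergent (P_star_seq M X u p T i)"
  proof -
    obtain L where L: "0 < L" "(\<lambda>n. \<P>(\<omega> in M. \<forall>j\<in>{1..n}. X j \<omega> \<le> u n)) \<longlonglongrightarrow> L" "\<theta>X = - (1 / \<tau>X) * ln L"
      using \<open>has_extremal_index M X 1 u \<tau>X \<theta>X\<close> unfolding has_extremal_index_def max_over_iffs by blast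
    \<comment> \<open>The comparison is read backwards for X: the void probabilities are known to
      converge, and \<open>0 < L\<close> permits taking logarithms to recover the limit of
      \<open>LX\<close>.\<close>
    have "(\<lambda>n. exp (- LX n)) \<longlonglongrightarrow> L"
      using tendsto_diff[OF L(2) X_void] by simp
    then have "(\<lambda>n. - ln (exp (- LX n))) \<longlonglongrightarrow> - ln L"
      using L(1) by (intro tendsto_intros) auto
    then have lamX: "LX \<longlonglongrightarrow> \<tau>X * \<theta>X" using L(3) \<open>0 < \<tau>X\<close> by simp
    define \<mu> where "\<mu> = \<tau>X * \<theta>X * p ^ (T - 1) + 1 / real T * (\<Sum>i=1..T - 1. P_star M X u p T i)"
    have "(\<lambda>n. LX n * p ^ (T - 1) + 1 / real T * (\<Sum>i=1..T - 1. P_star_seq M X u p T i n)) \<longlonglongrightarrow> \<mu>"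
      unfolding \<mu>_def P_star_def using conv by (intro tendsto_intros lamX) (simp add: convergent_LIMSEQ_iff)
    moreover have "eventually (\<lambda>n. LX n * p ^ (T - 1) + 1 / real T * (\<Sum>i=1..T - 1. P_star_seq M X u p T i n) = LY n) sequentially"
      using eventually_ge_at_top[of 1]
    proof eventually_elim
      case (elim n)
      show ?case unfolding LX_def LY_def by (rule Y_cluster_intensity[where u = u and n = n, OF u[OF elim], symmetric])
    qed
    ultimately have "LY \<longlonglongrightarrow> \<mu>" by (rule Lim_transform_eventually)
    then have "(\<lambda>n. exp (- LY n)) \<longlonglongrightarrow> exp (- \<mu>)" by (intro tendsto_intros)
    \<comment> \<open>Here the comparison is read forwards. The limit is an exponential, hence
      positive as the extremal index requires.\<close>
    then have "(\<lambda>n. \<P>(\<omega> in M. \<forall>j\<in>{1..n}. ?Y j \<omega> \<le> u n)) \<longlonglongrightarrow> exp (- \<mu>)"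
      using tendsto_add[OF Y_void] by fastforce
    moreover have "\<tau>X / \<tau> * \<theta>X * p ^ (T - 1) + 1 / (\<tau> * real T) * (\<Sum>i=1..T - 1. P_star M X u p T i) = - (1 / \<tau>) * ln (exp (- \<mu>))"
      unfolding \<mu>_def using \<tau>_pos T by (simp add: field_simps)
    ultimately show ?thesis
      unfolding has_extremal_index_def max_over_iffs using \<tau>_pos Y_intensity exp_gt_zero by blast
  qed
  then show ?thesis using D by blast
qed

end
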